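(* For any sparsity pattern $\mathcal{E}$ (the edge set of an undirected graph on $\{1,\ldots,r\}$), $$\mathit{DSOS}^r_{n,2d}(\mathcal{E})\subset \mathit{SDSOS}^r_{n,2d}(\mathcal{E})\subset \mathit{SSOS}^r_{n,2d}(\mathcal{E})\subseteq \mathit{SOS}^r_{n,2d}(\mathcal{E}),$$ and the first two inclusions are strict. The third inclusion is strict unless $\mathcal{E}$ is full, in which case $\mathit{SSOS}^r_{n,2d}(\mathcal{E})=\mathit{SOS}^r_{n,2d}(\mathcal{E})$.
   Context: Sparsity patterns. $\mathcal{G}(\mathcal{V},\mathcal{E})$ is an undirected graph with $\mathcal{V}=\{1,\ldots,r\}$ and $\mathcal{E}\subseteq\mathcal{V}\times\mathcal{V}$ such that $(i,j)\in\mathcal{E}$ implies $(j,i)\in\mathcal{E}$; put $\mathcal{E}^*=\mathcal{E}\cup\{(i,i): i\in\mathcal{V}\}$. $\mathcal{E}$ is full if it contains all edges, i.e. all pairs $(i,j)$ with $i\neq j$. Polynomial matrices. $\mathbb{R}[x]_{n,2d}$ is the set of real polynomials in $x=(x_1,\ldots,x_n)$ of degree at most $2d$; $\mathbb{R}[x]_{n,d}^{s\times r}$ is the set of $s\times r$ matrices with entries in $\mathbb{R}[x]_{n,d}$; $\mathbb{S}[x]^r_{n,2d}$ is the set of symmetric $r\times r$ matrices with entries in $\mathbb{R}[x]_{n,2d}$. The sparse space is $\mathbb{S}^r_{n,2d}(\mathcal{E},0)=\{P\in\mathbb{S}[x]^r_{n,2d}: P_{ij}(x)=P_{ji}(x)=0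 \text{ whenever } (i,j)\notin\mathcal{E}^*\}$. Gram matrices. Let $v_d(x)$ be the vector of all monomials in $x$ of degree at most $d$, of length $N=\binom{n+d}{d}$. A Gram matrix of $P\in\mathbb{S}[x]^r_{n,2d}$ is a symmetric $rN\times rN$ matrix $Q$ with $P(x)=(I_r\otimes v_d(x))^{\mathsf T}Q(I_r\otimes v_d(x))$, where $I_r$ is the $r\times r$ identity matrix and $\otimes$ the Kronecker product. Writing $Q$ in $N\times N$ blocks $Q_{ij}$, $i,j=1,\ldots,r$, this means $P_{ij}(x)=v_d(x)^{\mathsf T}Q_{ij}v_d(x)$. Diagonal dominance. A symmetric matrix $A$ is diagonally dominant (DD) if $A_{ii}\ge\sum_{j\ne i}|A_{ij}|$ for all $i$; it is scaled diagonally dominant (SDD) if there is a positive definite diagonal matrix $D$ such that $DAD$ is DD. Cones. $\mathit{SOS}^r_{n,2d}$ is the set of $P\in\mathbb{S}[x]^r_{n,2d}$ for which there exist $s$ and $M\in\mathbb{R}[x]^{s\times r}_{n,d}$ with $P(x)=M(x)^{\mathsf T}M(x)$ (equivalently, $P$ has a positive semidefinite Gram matrix). $\mathit{DSOS}^r_{n,2d}$ (resp. $\mathit{SDSOS}^r_{n,2d}$) is the set of $P\in\mathbb{S}[x]^r_{n,2d}$ having a DD (resp. SDD) Gram matrix. Then $\mathit{SOS}^r_{n,2d}(\mathcal{E})$, $\mathit{DSOS}^r_{n,2d}(\mathcal{E})$ and $\mathit{SDSOS}^r_{n,2d}(\mathcal{E})$ denote the intersections of these sets with $\mathbb{S}^r_{n,2d}(\mathcal{E},0)$.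 Finally, $\mathit{SSOS}^r_{n,2d}(\mathcal{E})$ is the set of $P\in\mathit{SOS}^r_{n,2d}(\mathcal{E})$ that have a positive semidefinite Gram matrix $Q$ with $Q_{ij}=0$ for all $(i,j)\notin\mathcal{E}^*$.
   Formalization: The first two inclusions are strict outside degenerate cases (r=0; nd=0 with no edge, resp. no cycle; for the second also n=d=1 with no edge), the third when n,d≥1 and the graph is not a disjoint union of complete graphs; in the excluded cases the cones are equal. *)

theory Defs
  imports
    "HOL-Library.Poly_Mapping"
    "Jordan_Normal_Form.Matrix"
begin

text \<open>
  A monomial is its exponent vector, a finitely supported map from variable indices to exponents;
  a polynomial is a finitely supported map from monomials to coefficients. Variables, vertices and
  matrix indices are counted from 0, so the variables are \<open>{..<n}\<close> and the vertices
  \<open>{..<r}\<close>.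
\<close>

type_synonym monom = "nat \<Rightarrow>\<^sub>0 nat"
type_synonym rpoly = "monom \<Rightarrow>\<^sub>0 real"

definition mdeg :: "monom \<Rightarrow> nat" where
  "mdeg m = (\<Sum>i\<in>Poly_Mapping.keys m. Poly_Mapping.lookup m i)"

definition monoms :: "nat \<Rightarrow> nat \<Rightarrow> monom set" where
  "monoms n d = {m. Poly_Mapping.keys m \<subseteq> {..<n} \<and> mdeg m \<le> d}"

definition polys :: "nat \<Rightarrow> nat \<Rightarrow> rpoly set" where
  "polys n d = {p. Poly_Mapping.keys p \<subseteq> monoms n d}"

definition poly_mats :: "nat \<Rightarrow> nat \<Rightarrow> nat \<Rightarrow> nat \<Rightarrow> rpoly mat set" where
  "poly_mats s r n d = {M \<in> carrier_mat s r. \<forall>i<s. \<forall>j<r. M $$ (i, j) \<in> polys n d}"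

definition sym_poly_mats :: "nat \<Rightarrow> nat \<Rightarrow> nat \<Rightarrow> rpoly mat set" where
  "sym_poly_mats r n k = {P \<in> poly_mats r r n k. transpose_mat P = P}"


subsection \<open>Sparsity patterns\<close>

definition sparsity_pattern :: "nat \<Rightarrow> (nat \<times> nat) set \<Rightarrow> bool" where
  "sparsity_pattern r E \<longleftrightarrow> E \<subseteq> {..<r} \<times> {..<r} \<and> sym E"

definition star_pattern :: "nat \<Rightarrow> (nat \<times> nat) set \<Rightarrow> (nat \<times> nat) set" where
  "star_pattern r E = E \<union> {(i, i) | i. i < r}"

text \<open>
  For a sparsity pattern, \<open>star_pattern r E\<close> is reflexive on the vertices and symmetric, so it is
  transitive exactly when the graph is a disjoint union of complete graphs. In that case every
  sum-of-squares matrix with pattern \<open>E\<close> is block diagonal up to a permutation of the vertices and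
  has a Gram matrix with the same pattern. The predicates \<open>has_edge\<close> and \<open>has_cycle\<close> likewise serve
  to set apart the degenerate parameters for which two of the cones coincide.
\<close>

definition full_pattern :: "nat \<Rightarrow> (nat \<times> nat) set \<Rightarrow> bool" where
  "full_pattern r E \<longleftrightarrow> (\<forall>i<r. \<forall>j<r. i \<noteq> j \<longrightarrow> (i, j) \<in> E)"

definition has_edge :: "(nat \<times> nat) set \<Rightarrow> bool" where
  "has_edge E \<longleftrightarrow> (\<exists>i j. (i, j) \<in> E \<and> i \<noteq> j)"

definition has_cycle :: "(nat \<times> nat) set \<Rightarrow> bool" where
  "has_cycle E \<longleftrightarrow> (\<exists>vs. 3 \<le> length vs \<and> distinct vs \<and>
     (\<forall>k<length vs. (vs ! k, vs ! (Suc k mod length vs)) \<in> E))"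

definition sparse_mats :: "nat \<Rightarrow> nat \<Rightarrow> nat \<Rightarrow> (nat \<times> nat) set \<Rightarrow> rpoly mat set" where
  "sparse_mats r n k E = {P \<in> sym_poly_mats r n k.
     \<forall>i<r. \<forall>j<r. (i, j) \<notin> star_pattern r E \<longrightarrow> P $$ (i, j) = 0 \<and> P $$ (j, i) = 0}"


subsection \<open>Gram matrices\<close>

text \<open>
  The order of the monomials in \<open>v\<^sub>d\<close> is the linear order on finitely supported maps; it
  plays no role in the cones below. The lemma \<open>length_monom_list\<close> confirms that
  \<open>v\<^sub>d\<close> has length \<open>(n + d) choose d\<close>.
\<close>

definition monom_list :: "nat \<Rightarrow> nat \<Rightarrow> monom list" where
  "monom_list n d = sorted_list_of_set (monoms n d)"

definition monom_count :: "nat \<Rightarrow> nat \<Rightarrow> nat" where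
  "monom_count n d = (n + d) choose d"

definition monom_vec :: "nat \<Rightarrow> nat \<Rightarrow> rpoly mat" where
  "monom_vec n d = mat (monom_count n d) 1
     (\<lambda>(a, _). Poly_Mapping.single (monom_list n d ! a) 1)"

definition kron :: "'a::times mat \<Rightarrow> 'a mat \<Rightarrow> 'a mat" where
  "kron A B = mat (dim_row A * dim_row B) (dim_col A * dim_col B)
     (\<lambda>(i, j). A $$ (i div dim_row B, j div dim_col B) * B $$ (i mod dim_row B, j mod dim_col B))"

definition const_mat :: "real mat \<Rightarrow> rpoly mat" where
  "const_mat Q = map_mat (Poly_Mapping.single 0) Q"

definition gram_matrix :: "nat \<Rightarrow> nat \<Rightarrow> nat \<Rightarrow> rpoly mat \<Rightarrow> real mat \<Rightarrow> bool" where
  "gram_matrix r n d P Q \<longleftrightarrow>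
     Q \<in> carrier_mat (r * monom_count n d) (r * monom_count n d) \<and> transpose_mat Q = Q \<and>
     P = transpose_mat (kron (1\<^sub>m r) (monom_vec n d)) * const_mat Q * kron (1\<^sub>m r) (monom_vec n d)"

definition block :: "nat \<Rightarrow> real mat \<Rightarrow> nat \<Rightarrow> nat \<Rightarrow> real mat" where
  "block N Q i j = mat N N (\<lambda>(a, b). Q $$ (i * N + a, j * N + b))"


subsection \<open>Classes of symmetric matrices\<close>

definition psd :: "real mat \<Rightarrow> bool" where
  "psd A \<longleftrightarrow> square_mat A \<and> transpose_mat A = A \<and>
     (\<forall>x \<in> carrier_vec (dim_row A). x \<bullet> (A *\<^sub>v x) \<ge> 0)"

definition pos_def :: "real mat \<Rightarrow> bool" where
  "pos_def A \<longleftrightarrow> square_mat A \<and> transpose_mat A = A \<and>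
     (\<forall>x \<in> carrier_vec (dim_row A). x \<noteq> 0\<^sub>v (dim_row A) \<longrightarrow> x \<bullet> (A *\<^sub>v x) > 0)"

definition diag_dominant :: "real mat \<Rightarrow> bool" where
  "diag_dominant A \<longleftrightarrow> square_mat A \<and> transpose_mat A = A \<and>
     (\<forall>i<dim_row A. A $$ (i, i) \<ge> (\<Sum>j \<in> {..<dim_row A} - {i}. \<bar>A $$ (i, j)\<bar>))"

definition scaled_diag_dominant :: "real mat \<Rightarrow> bool" where
  "scaled_diag_dominant A \<longleftrightarrow> square_mat A \<and> transpose_mat A = A \<and>
     (\<exists>D \<in> carrier_mat (dim_row A) (dim_row A).
        diagonal_mat D \<and> pos_def D \<and> diag_dominant (D * A * D))"


subsection \<open>Cones of polynomial matrices\<close>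

text \<open>
  The parameter \<open>d\<close> is half of the degree bound: the matrices below have entries of degree at
  most \<open>2 * d\<close>.
\<close>

definition SOS :: "nat \<Rightarrow> nat \<Rightarrow> nat \<Rightarrow> rpoly mat set" where
  "SOS r n d = {P \<in> sym_poly_mats r n (2 * d).
     \<exists>s. \<exists>M \<in> poly_mats s r n d. P = transpose_mat M * M}"

definition DSOS :: "nat \<Rightarrow> nat \<Rightarrow> nat \<Rightarrow> rpoly mat set" where
  "DSOS r n d = {P \<in> sym_poly_mats r n (2 * d). \<exists>Q. gram_matrix r n d P Q \<and> diag_dominant Q}"

definition SDSOS :: "nat \<Rightarrow> nat \<Rightarrow> nat \<Rightarrow> rpoly mat set" where
  "SDSOS r n d =
     {P \<in> sym_poly_mats r n (2 * d). \<exists>Q. gram_matrix r n d P Q \<and> scaled_diag_dominant Q}"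

definition SOS_on :: "nat \<Rightarrow> nat \<Rightarrow> nat \<Rightarrow> (nat \<times> nat) set \<Rightarrow> rpoly mat set" where
  "SOS_on r n d E = SOS r n d \<inter> sparse_mats r n (2 * d) E"

definition DSOS_on :: "nat \<Rightarrow> nat \<Rightarrow> nat \<Rightarrow> (nat \<times> nat) set \<Rightarrow> rpoly mat set" where
  "DSOS_on r n d E = DSOS r n d \<inter> sparse_mats r n (2 * d) E"

definition SDSOS_on :: "nat \<Rightarrow> nat \<Rightarrow> nat \<Rightarrow> (nat \<times> nat) set \<Rightarrow> rpoly mat set" where
  "SDSOS_on r n d E = SDSOS r n d \<inter> sparse_mats r n (2 * d) E"

definition SSOS_on :: "nat \<Rightarrow> nat \<Rightarrow> nat \<Rightarrow> (nat \<times> nat) set \<Rightarrow> rpoly mat set" where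
  "SSOS_on r n d E = {P \<in> SOS_on r n d E. \<exists>Q. gram_matrix r n d P Q \<and> psd Q \<and>
     (\<forall>i<r. \<forall>j<r. (i, j) \<notin> star_pattern r E \<longrightarrow>
        block (monom_count n d) Q i j = 0\<^sub>m (monom_count n d) (monom_count n d))}"


subsection \<open>The number of monomials\<close>

lemma mdeg_superset:
  assumes "finite A" "Poly_Mapping.keys m \<subseteq> A"
  shows "mdeg m = (\<Sum>i\<in>A. Poly_Mapping.lookup m i)"
  unfolding mdeg_def using assms
  by (intro sum.mono_neutral_left) (auto simp: in_keys_iff)

lemma mdeg_zero_iff: "mdeg m = 0 \<longleftrightarrow> m = 0"
  by (auto simp: mdeg_def in_keys_iff intro!: poly_mapping_eqI)

lemma mdeg_add: "mdeg (m + m') = mdeg m + mdeg m'"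
proof -
  let ?A = "Poly_Mapping.keys m \<union> Poly_Mapping.keys m'"
  have "Poly_Mapping.keys (m + m') \<subseteq> ?A" by (rule Poly_Mapping.keys_add)
  then show ?thesis
    using mdeg_superset[of ?A m] mdeg_superset[of ?A m'] mdeg_superset[of ?A "m + m'"]
    by (simp add: lookup_add sum.distrib)
qed

lemma mdeg_single: "mdeg (Poly_Mapping.single i k) = k"
  by (cases "k = 0") (auto simp: mdeg_def)

lemma monoms_degree_0: "monoms n 0 = {0}"
  by (auto simp: monoms_def mdeg_zero_iff)

lemma monoms_no_variables: "monoms 0 d = {0}"
  by (auto simp: monoms_def mdeg_def)

lemma monoms_Suc_Suc:
  "monoms (Suc n) (Suc d) =
     monoms n (Suc d) \<union> (\<lambda>m. Poly_Mapping.single n 1 + m) ` monoms (Suc n) d"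
proof (intro equalityI subsetI)
  fix m assume m: "m \<in> monoms (Suc n) (Suc d)"
  show "m \<in> monoms n (Suc d) \<union> (\<lambda>m. Poly_Mapping.single n 1 + m) ` monoms (Suc n) d"
  proof (cases "n \<in> Poly_Mapping.keys m")
    case False
    then have "Poly_Mapping.keys m \<subseteq> {..<n}"
      using m by (auto simp: monoms_def less_Suc_eq)
    then show ?thesis using m by (simp add: monoms_def)
  next
    case True
    define m' where "m' = m - Poly_Mapping.single n 1"
    have eq: "m = Poly_Mapping.single n 1 + m'"
      using True unfolding m'_def
      by (intro poly_mapping_eqI)
        (auto simp: lookup_add lookup_minus lookup_single when_def in_keys_iff)
    have "Poly_Mapping.keys m' \<subseteq> Poly_Mapping.keys m"
      by (auto simp: m'_def in_keys_iff lookup_minus)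
    moreover have "mdeg m = 1 + mdeg m'"
      by (simp add: eq mdeg_add mdeg_single)
    ultimately have "m' \<in> monoms (Suc n) d"
      using m by (auto simp: monoms_def)
    then show ?thesis using eq by blast
  qed
next
  fix m assume "m \<in> monoms n (Suc d) \<union> (\<lambda>m. Poly_Mapping.single n 1 + m) ` monoms (Suc n) d"
  then show "m \<in> monoms (Suc n) (Suc d)"
  proof
    assume "m \<in> monoms n (Suc d)"
    then show ?thesis by (auto simp: monoms_def less_Suc_eq)
  next
    assume "m \<in> (\<lambda>m. Poly_Mapping.single n 1 + m) ` monoms (Suc n) d"
    then obtain m' where m': "m' \<in> monoms (Suc n) d" "m = Poly_Mapping.single n 1 + m'" by blast
    have "Poly_Mapping.keys m \<subseteq> {n} \<union> Poly_Mapping.keys m'"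
      using Poly_Mapping.keys_add[of "Poly_Mapping.single n 1" m'] m'(2) by simp
    then show ?thesis using m' by (auto simp: monoms_def mdeg_add mdeg_single)
  qed
qed

lemma finite_card_monoms: "finite (monoms n d) \<and> card (monoms n d) = (n + d) choose d"
proof (induction "n + d" arbitrary: n d rule: less_induct)
  case less
  show ?case
  proof (cases n)
    case 0
    then show ?thesis by (simp add: monoms_no_variables)
  next
    case n: (Suc n')
    show ?thesis
    proof (cases d)
      case 0
      then show ?thesis by (simp add: monoms_degree_0)
    next
      case d: (Suc d')
      let ?f = "\<lambda>m. Poly_Mapping.single n' 1 + m :: monom"
      have 1: "finite (monoms n' (Suc d'))" "card (monoms n' (Suc d')) = (n' + Suc d') choose Suc d'"
        using less[of n' "Suc d'"] n d by auto
      have 2: "finite (monoms (Suc n') d')" "card (monoms (Suc n') d') = (Suc n' + d') choose d'"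
        using less[of "Suc n'" d'] n d by auto
      have disj: "monoms n' (Suc d') \<inter> ?f ` monoms (Suc n') d' = {}"
      proof (rule ccontr)
        assume "\<not> ?thesis"
        then obtain m where "?f m \<in> monoms n' (Suc d')" by blast
        moreover have "n' \<in> Poly_Mapping.keys (?f m)"
          by (simp add: in_keys_iff lookup_add)
        ultimately show False by (auto simp: monoms_def)
      qed
      have "card (monoms (Suc n') (Suc d')) =
          card (monoms n' (Suc d')) + card (?f ` monoms (Suc n') d')"
        unfolding monoms_Suc_Suc using 1 2 disj by (intro card_Un_disjoint) auto
      also have "card (?f ` monoms (Suc n') d') = card (monoms (Suc n') d')"
        by (rule card_image) (simp add: inj_on_def)
      finally show ?thesis
        using 1 2 n d monoms_Suc_Suc[of n' d'] by simp
    qed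
  qed
qed

lemma length_monom_list: "length (monom_list n d) = monom_count n d"
  by (simp add: monom_list_def monom_count_def finite_card_monoms)

lemma set_monom_list: "set (monom_list n d) = monoms n d"
  by (simp add: monom_list_def finite_card_monoms)

end

theory Submission
  imports Defs
begin

text \<open>
  Blocks outside the pattern can be deleted from a scaled diagonally dominant Gram matrix without
  losing scaled dominance, and a scaled diagonally dominant matrix is a sum of squares of vectors
  with at most two nonzero entries; this gives the inclusions.

  Strictness of the first inclusion: the Gram matrix of the vector \<open>(1, 2)\<close>, placed at two
  indices whose entries are determined by the polynomial matrix, is not diagonally dominant.
  For the second inclusion, every scaled diagonally dominant \<open>A\<close> satisfies
  \<open>\<Sum>\<^sub>u A\<^sub>u\<^sub>u \<ge> \<Sum>\<^sub>u\<^sub>\<noteq>\<^sub>v |A\<^sub>u\<^sub>v|\<close> by the inequality of the means, so functionals with coefficients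
  \<open>\<plusminus>1\<close>, equal to \<open>1\<close> on squares, are nonnegative on \<open>SDSOS\<close>; a positive semidefinite matrix supported
  on a cycle of at least three Gram indices, with exactly one positive edge on the cycle, violates
  this.
  The four sources of nondegeneracy each supply such a cycle: a cycle of the graph at the constant
  monomial, \<open>1, y, x\<close> or \<open>1, x\<^sup>2, x\<close> at one vertex, or \<open>1, x\<close> at one end and \<open>1\<close> at the other end
  of an edge.

  For the third inclusion take a path \<open>i, j, k\<close> without the edge \<open>(i, k)\<close> and the columns
  \<open>(x, 1)\<close>, \<open>(1, 0)\<close>, \<open>(1, -x)\<close>, of which the outer two are orthogonal. In a positive semidefinite
  Gram matrix \<open>Q\<close> with vanishing \<open>(i, k)\<close> block, \<open>e\<^sub>k\<^sub>,\<^sub>1 - e\<^sub>j\<^sub>,\<^sub>1\<close> is isotropic, hence in the kernel; but row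
  \<open>(i, x)\<close> of \<open>Q\<close> pairs with it to \<open>-1\<close>.
\<close>

section \<open>Indexing Gram matrices by a vertex and a monomial\<close>

lemma monom_count_pos: "0 < monom_count n d"
  by (simp add: monom_count_def)

lemma finite_monoms: "finite (monoms n d)"
  by (simp add: finite_card_monoms)

lemma zero_in_monoms: "0 \<in> monoms n d"
  by (simp add: monoms_def mdeg_def)

lemma monom_list_bij: "bij_betw (\<lambda>a. monom_list n d ! a) {..<monom_count n d} (monoms n d)"
  by (rule bij_betw_nth)
    (simp_all add: length_monom_list set_monom_list, simp add: monom_list_def)

text \<open>Labels replace matrix positions in the arguments below: the vertex selects a block and
  the monomial a place inside it. The quotients and remainders in \<open>kron\<close> then occur
  only in the translation lemmas.\<close>

definition gram_index :: "nat \<Rightarrow> nat \<Rightarrow> nat \<Rightarrow> (nat \<times> monom) set" where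
  "gram_index r n d = {..<r} \<times> monoms n d"

definition gram_label :: "nat \<Rightarrow> nat \<Rightarrow> nat \<Rightarrow> nat \<times> monom" where
  "gram_label n d u = (u div monom_count n d, monom_list n d ! (u mod monom_count n d))"

text \<open>The inverse of \<open>gram_label\<close>; its value carries information only when the
  monomial lies in \<open>monoms n d\<close>.\<close>

definition gram_pos :: "nat \<Rightarrow> nat \<Rightarrow> nat \<times> monom \<Rightarrow> nat" where
  "gram_pos n d u = fst u * monom_count n d +
     the_inv_into {..<monom_count n d} (\<lambda>a. monom_list n d ! a) (snd u)"

definition gram_entry :: "nat \<Rightarrow> nat \<Rightarrow> real mat \<Rightarrow> nat \<times> monom \<Rightarrow> nat \<times> monom \<Rightarrow> real" where
  "gram_entry n d Q u v = Q $$ (gram_pos n d u, gram_pos n d v)"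

lemma finite_gram_index: "finite (gram_index r n d)"
  by (simp add: gram_index_def finite_monoms)

lemma gram_indexD: "u \<in> gram_index r n d \<Longrightarrow> fst u < r" "u \<in> gram_index r n d \<Longrightarrow> snd u \<in> monoms n d"
  by (auto simp: gram_index_def)

lemma gram_pos_nth:
  assumes "a < monom_count n d"
  shows "gram_pos n d (i, monom_list n d ! a) = i * monom_count n d + a"
  using assms monom_list_bij[of n d]
  by (simp add: gram_pos_def the_inv_into_f_f[of "\<lambda>a. monom_list n d ! a"] bij_betw_def)

lemma nth_in_monoms: "a < monom_count n d \<Longrightarrow> monom_list n d ! a \<in> monoms n d"
  using monom_list_bij[of n d] by (auto simp: bij_betw_def)

lemma obtain_monom_index:
  assumes "p \<in> monoms n d"
  obtains a where "a < monom_count n d" "p = monom_list n d ! a"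
  using assms monom_list_bij[of n d] by (auto simp: bij_betw_def)

lemma block_index_less:
  fixes i a N :: nat
  assumes "i < r" "a < N"
  shows "i * N + a < r * N"
proof -
  have "i * N + a < Suc i * N" using assms(2) by simp
  also have "\<dots> \<le> r * N" using assms(1) by (intro mult_le_mono1) simp
  finally show ?thesis .
qed

lemma gram_label_pos: "u \<in> gram_index r n d \<Longrightarrow> gram_label n d (gram_pos n d u) = u"
  by (cases u) (auto simp: gram_index_def gram_label_def gram_pos_nth elim!: obtain_monom_index)

lemma gram_pos_less: "u \<in> gram_index r n d \<Longrightarrow> gram_pos n d u < r * monom_count n d"
  by (cases u) (auto simp: gram_index_def gram_pos_nth block_index_less elim!: obtain_monom_index)

lemma gram_label_in: "u < r * monom_count n d \<Longrightarrow> gram_label n d u \<in> gram_index r n d"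
  using monom_count_pos[of n d]
  by (auto simp: gram_index_def gram_label_def less_mult_imp_div_less intro!: nth_in_monoms)

lemma gram_pos_label: "gram_pos n d (gram_label n d u) = u"
  by (simp add: gram_label_def gram_pos_nth monom_count_pos div_mult_mod_eq)

lemma gram_pos_bij: "bij_betw (gram_pos n d) (gram_index r n d) {..<r * monom_count n d}"
  by (rule bij_betw_byWitness[where f' = "gram_label n d"])
    (auto simp: gram_label_pos gram_pos_label gram_pos_less gram_label_in)

lemma sum_gram_index:
  "(\<Sum>u<r * monom_count n d. f u) = (\<Sum>u\<in>gram_index r n d. f (gram_pos n d u))"
  by (rule sum.reindex_bij_betw[OF gram_pos_bij, symmetric])

lemma gram_entry_label: "gram_entry n d Q (gram_label n d u) (gram_label n d v) = Q $$ (u, v)"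
  by (simp add: gram_entry_def gram_pos_label)

subsection \<open>Coefficients of Gram matrices\<close>

lemma mult_mat_entry:
  assumes "A \<in> carrier_mat a b" "B \<in> carrier_mat b c" "i < a" "j < c"
  shows "(A * B) $$ (i, j) = (\<Sum>u<b. A $$ (i, u) * B $$ (u, j))"
  using assms by (simp add: scalar_prod_def lessThan_atLeast0)

abbreviation "monom_kron r n d \<equiv> kron (1\<^sub>m r) (monom_vec n d)"

lemma monom_kron_carrier: "monom_kron r n d \<in> carrier_mat (r * monom_count n d) r"
  by (simp add: kron_def monom_vec_def)

lemma monom_kron_entry:
  assumes "u \<in> gram_index r n d" "j < r"
  shows "monom_kron r n d $$ (gram_pos n d u, j) =
    (if fst u = j then Poly_Mapping.single (snd u) 1 else 0)"
proof -
  have "gram_pos n d u mod monom_count n d < monom_count n d"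
    by (simp add: monom_count_pos)
  moreover have "gram_pos n d u div monom_count n d = fst u"
    "monom_list n d ! (gram_pos n d u mod monom_count n d) = snd u"
    using gram_label_pos[OF assms(1)] by (auto simp: gram_label_def prod_eq_iff)
  ultimately show ?thesis
    using gram_pos_less[OF assms(1)] gram_indexD(1)[OF assms(1)] assms(2)
    by (auto simp: kron_def monom_vec_def)
qed

text \<open>Constants embed the reals into the polynomials, which lets \<open>const_mat\<close> pass
  through matrix products.\<close>

lemma semiring_hom_const: "semiring_hom (Poly_Mapping.single 0 :: real \<Rightarrow> rpoly)"
  by unfold_locales (simp_all add: single_add mult_single)

lemma const_mat_mult:
  "A \<in> carrier_mat s k \<Longrightarrow> B \<in> carrier_mat k t \<Longrightarrow> const_mat (A * B) = const_mat A * const_mat B"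
  unfolding const_mat_def by (rule semiring_hom.mat_hom_mult[OF semiring_hom_const])

lemma const_mat_carrier: "A \<in> carrier_mat s k \<Longrightarrow> const_mat A \<in> carrier_mat s k"
  by (simp add: const_mat_def)

lemma const_mat_transpose: "const_mat (transpose_mat A) = transpose_mat (const_mat A)"
  by (auto simp: const_mat_def)

text \<open>Column \<open>j\<close> of the Kronecker product is supported on block \<open>j\<close>.
  Hence a row of \<open>C\<close> lists the coefficients of a row of polynomials, and factors
  \<open>M\<close> of a sum of squares correspond to real matrices \<open>C\<close>.\<close>

lemma const_mat_kron_entry:
  assumes C: "C \<in> carrier_mat s (r * monom_count n d)" and "k < s" "j < r"
  shows "(const_mat C * monom_kron r n d) $$ (k, j) =
    (\<Sum>p\<in>monoms n d. Poly_Mapping.single p (C $$ (k, gram_pos n d (j, p))))"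
proof -
  have "(const_mat C * monom_kron r n d) $$ (k, j) =
      (\<Sum>u<r * monom_count n d. const_mat C $$ (k, u) * monom_kron r n d $$ (u, j))"
    by (rule mult_mat_entry[OF const_mat_carrier[OF C] monom_kron_carrier assms(2,3)])
  also have "\<dots> = (\<Sum>u\<in>gram_index r n d. 
      if fst u = j then Poly_Mapping.single (snd u) (C $$ (k, gram_pos n d u)) else 0)"
    unfolding sum_gram_index using assms
    by (intro sum.cong)
      (auto simp: monom_kron_entry mult_single const_mat_def gram_pos_less)
  also have "\<dots> = (\<Sum>i<r. \<Sum>p\<in>monoms n d.
      if i = j then Poly_Mapping.single p (C $$ (k, gram_pos n d (i, p))) else 0)"
    unfolding gram_index_def sum.cartesian_product by (intro sum.cong) auto
  also have "\<dots> = (\<Sum>i<r. if i = j then \<Sum>p\<in>monoms n d.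
      Poly_Mapping.single p (C $$ (k, gram_pos n d (i, p))) else 0)"
    by (intro sum.cong) auto
  also have "\<dots> = (\<Sum>p\<in>monoms n d. Poly_Mapping.single p (C $$ (k, gram_pos n d (j, p))))"
    using \<open>j < r\<close> by simp
  finally show ?thesis .
qed

text \<open>This is the blockwise identity \<open>P_ij = v^T Q_ij v\<close>: the outer factors keep
  only the rows of block \<open>i\<close> and the columns of block \<open>j\<close>.\<close>

lemma gram_product_entry:
  assumes Q: "Q \<in> carrier_mat (r * monom_count n d) (r * monom_count n d)" and ij: "i < r" "j < r"
  shows "(transpose_mat (monom_kron r n d) * const_mat Q * monom_kron r n d) $$ (i, j) =
    (\<Sum>p\<in>monoms n d. \<Sum>q\<in>monoms n d.
       Poly_Mapping.single (p + q) (gram_entry n d Q (i, p) (j, q)))"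
proof -
  let ?K = "monom_kron r n d" and ?L = "r * monom_count n d"
  have K: "?K \<in> carrier_mat ?L r" by (rule monom_kron_carrier)
  have QK: "const_mat Q * ?K \<in> carrier_mat ?L r"
    using K const_mat_carrier[OF Q] by simp
  have "(transpose_mat ?K * const_mat Q * ?K) $$ (i, j) =
      (transpose_mat ?K * (const_mat Q * ?K)) $$ (i, j)"
    by (subst assoc_mult_mat[where ?n\<^sub>1.0 = r and ?n\<^sub>2.0 = ?L and ?n\<^sub>3.0 = ?L and ?n\<^sub>4.0 = r])
      (use K const_mat_carrier[OF Q] in simp_all)
  also have "\<dots> = (\<Sum>u<?L. ?K $$ (u, i) * (const_mat Q * ?K) $$ (u, j))"
    using ij K by (subst mult_mat_entry[OF _ QK]) auto
  also have "\<dots> = (\<Sum>u\<in>gram_index r n d. if fst u = i then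
      (\<Sum>q\<in>monoms n d. Poly_Mapping.single (snd u + q) (gram_entry n d Q u (j, q))) else 0)"
    unfolding sum_gram_index
    by (intro sum.cong refl)
      (simp add: monom_kron_entry ij const_mat_kron_entry[OF Q] gram_pos_less
        sum_distrib_left mult_single gram_entry_def)
  also have "\<dots> = (\<Sum>k<r. \<Sum>p\<in>monoms n d. if k = i then
      (\<Sum>q\<in>monoms n d. Poly_Mapping.single (p + q) (gram_entry n d Q (k, p) (j, q))) else 0)"
    unfolding gram_index_def sum.cartesian_product by (intro sum.cong) auto
  also have "\<dots> = (\<Sum>k<r. if k = i then \<Sum>p\<in>monoms n d. 
      \<Sum>q\<in>monoms n d. Poly_Mapping.single (p + q) (gram_entry n d Q (k, p) (j, q)) else 0)"
    by (intro sum.cong) auto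
  also have "\<dots> = (\<Sum>p\<in>monoms n d. \<Sum>q\<in>monoms n d. 
       Poly_Mapping.single (p + q) (gram_entry n d Q (i, p) (j, q)))"
    using ij by simp
  finally show ?thesis .
qed

lemma gram_matrixD:
  assumes "gram_matrix r n d P Q"
  shows "Q \<in> carrier_mat (r * monom_count n d) (r * monom_count n d)" "transpose_mat Q = Q"
    "P \<in> carrier_mat r r"
  using assms monom_kron_carrier[of r n d] by (auto simp: gram_matrix_def)

text \<open>\<open>P\<close> sees a block of \<open>Q\<close> only through its sums over the
  factorizations of each monomial. Entries at a monomial with a single factorization are therefore
  determined by \<open>P\<close>.\<close>

lemma gram_coeff:
  assumes "gram_matrix r n d P Q" "i < r" "j < r"
  shows "Poly_Mapping.lookup (P $$ (i, j)) m =
    (\<Sum>p\<in>monoms n d. \<Sum>q\<in>monoms n d. if p + q = m then gram_entry n d Q (i, p) (j, q) else 0)"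
proof -
  have "P $$ (i, j) = (\<Sum>p\<in>monoms n d. \<Sum>q\<in>monoms n d.
       Poly_Mapping.single (p + q) (gram_entry n d Q (i, p) (j, q)))"
    using assms gram_product_entry[OF gram_matrixD(1)[OF assms(1)] assms(2,3)]
    by (simp add: gram_matrix_def)
  then show ?thesis
    by (simp add: lookup_sum lookup_single when_def)
qed

lemma gram_entry_sym:
  assumes "Q \<in> carrier_mat (r * monom_count n d) (r * monom_count n d)" "transpose_mat Q = Q"
    "u \<in> gram_index r n d" "v \<in> gram_index r n d"
  shows "gram_entry n d Q u v = gram_entry n d Q v u"
proof -
  have "transpose_mat Q $$ (gram_pos n d u, gram_pos n d v) = Q $$ (gram_pos n d v, gram_pos n d u)"
    using assms(1) gram_pos_less[OF assms(3)] gram_pos_less[OF assms(4)] by simp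
  then show ?thesis using assms(2) by (simp add: gram_entry_def)
qed

lemma monoms_add: "p \<in> monoms n d \<Longrightarrow> q \<in> monoms n e \<Longrightarrow> p + q \<in> monoms n (d + e)"
  using Poly_Mapping.keys_add[of p q] by (auto simp: monoms_def mdeg_add)

text \<open>A monomial that is not a product of two monomials of degree at most \<open>d\<close>
  receives only zero terms in \<open>gram_coeff\<close>, and symmetry of \<open>Q\<close> exchanges
  the two factors. Matrices given by a Gram matrix thus need no separate degree check.\<close>

lemma gram_matrix_sym_poly_mats:
  assumes G: "gram_matrix r n d P Q"
  shows "P \<in> sym_poly_mats r n (2 * d)"
proof -
  note D = gram_matrixD[OF G]
  have "P $$ (i, j) \<in> polys n (2 * d)" if ij: "i < r" "j < r" for i j
    unfolding polys_def
  proof (safe)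
    fix m assume "m \<in> Poly_Mapping.keys (P $$ (i, j))"
    then have nz: "Poly_Mapping.lookup (P $$ (i, j)) m \<noteq> 0" by (simp add: in_keys_iff)
    have "\<exists>p\<in>monoms n d. \<exists>q\<in>monoms n d. p + q = m"
    proof (rule ccontr)
      assume "\<not> ?thesis"
      then have "Poly_Mapping.lookup (P $$ (i, j)) m = 0"
        unfolding gram_coeff[OF G ij] by (intro sum.neutral ballI) auto
      with nz show False by simp
    qed
    then obtain p q where "p \<in> monoms n d" "q \<in> monoms n d" "p + q = m" by blast
    then show "m \<in> monoms n (2 * d)" using monoms_add[of p n d q d] by (simp add: mult_2)
  qed
  moreover have "P $$ (j, i) = P $$ (i, j)" if ij: "i < r" "j < r" for i j
  proof (rule poly_mapping_eqI)
    fix m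
    have "Poly_Mapping.lookup (P $$ (j, i)) m = (\<Sum>p\<in>monoms n d. \<Sum>q\<in>monoms n d.
        if p + q = m then gram_entry n d Q (j, p) (i, q) else 0)"
      by (rule gram_coeff[OF G that(2,1)])
    also have "\<dots> = (\<Sum>q\<in>monoms n d. \<Sum>p\<in>monoms n d.
        if p + q = m then gram_entry n d Q (j, p) (i, q) else 0)"
      by (rule sum.swap)
    also have "\<dots> = (\<Sum>q\<in>monoms n d. \<Sum>p\<in>monoms n d.
        if q + p = m then gram_entry n d Q (i, q) (j, p) else 0)"
      using ij by (intro sum.cong refl)
        (auto simp: add.commute gram_index_def intro!: gram_entry_sym[OF D(1,2)])
    also have "\<dots> = Poly_Mapping.lookup (P $$ (i, j)) m"
      by (rule gram_coeff[OF G ij, symmetric])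
    finally show "Poly_Mapping.lookup (P $$ (j, i)) m = Poly_Mapping.lookup (P $$ (i, j)) m" .
  qed
  ultimately show ?thesis
    using D(3) by (auto simp: sym_poly_mats_def poly_mats_def intro!: eq_matI)
qed

text \<open>Lets Gram matrices be prescribed on labels; the separating examples are built this
  way.\<close>

definition gram_of :: "nat \<Rightarrow> nat \<Rightarrow> nat \<Rightarrow> (nat \<times> monom \<Rightarrow> nat \<times> monom \<Rightarrow> real) \<Rightarrow> real mat" where
  "gram_of r n d G = mat (r * monom_count n d) (r * monom_count n d)
     (\<lambda>(u, v). G (gram_label n d u) (gram_label n d v))"

lemma gram_of_carrier: "gram_of r n d G \<in> carrier_mat (r * monom_count n d) (r * monom_count n d)"
  by (simp add: gram_of_def)

lemma gram_entry_of:
  "u \<in> gram_index r n d \<Longrightarrow> v \<in> gram_index r n d \<Longrightarrow> gram_entry n d (gram_of r n d G) u v = G u v"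
  by (simp add: gram_entry_def gram_of_def gram_pos_less gram_label_pos)

lemma gram_of_sym:
  assumes "\<And>u v. u \<in> gram_index r n d \<Longrightarrow> v \<in> gram_index r n d \<Longrightarrow> G u v = G v u"
  shows "transpose_mat (gram_of r n d G) = gram_of r n d G"
  by (rule eq_matI) (simp_all add: gram_of_def assms gram_label_in)

lemma gram_matrix_of:
  assumes "\<And>u v. u \<in> gram_index r n d \<Longrightarrow> v \<in> gram_index r n d \<Longrightarrow> G u v = G v u"
  obtains P where "gram_matrix r n d P (gram_of r n d G)"
  using gram_of_sym[OF assms] gram_of_carrier[of r n d G] by (simp add: gram_matrix_def)

text \<open>Exchanges one Gram matrix of \<open>P\<close> for another: the first fixes the shape of
  \<open>P\<close>, the second has to match the coefficients.\<close>

lemma gram_matrix_transfer: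
  assumes G: "gram_matrix r n d P Q"
    and Q': "Q' \<in> carrier_mat (r * monom_count n d) (r * monom_count n d)" "transpose_mat Q' = Q'"
    and eq: "\<And>i j m. i < r \<Longrightarrow> j < r \<Longrightarrow> Poly_Mapping.lookup (P $$ (i, j)) m =
      (\<Sum>p\<in>monoms n d. \<Sum>q\<in>monoms n d. if p + q = m then gram_entry n d Q' (i, p) (j, q) else 0)"
  shows "gram_matrix r n d P Q'"
proof -
  define P' where
    "P' = transpose_mat (monom_kron r n d) * const_mat Q' * monom_kron r n d"
  have G': "gram_matrix r n d P' Q'" using Q' by (simp add: gram_matrix_def P'_def)
  have "P = P'"
    using gram_matrixD(3)[OF G] gram_matrixD(3)[OF G']
    by (intro eq_matI poly_mapping_eqI) (auto simp: eq gram_coeff[OF G'])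
  then show ?thesis using G' by simp
qed

subsection \<open>Factored Gram matrices\<close>

text \<open>With \<open>Q\<close> written as a sum of rank-one matrices, the quadratic form is a sum
  over \<open>K\<close> of squares of linear forms.\<close>

lemma gram_factor_psd:
  assumes Q: "Q \<in> carrier_mat (r * monom_count n d) (r * monom_count n d)" "transpose_mat Q = Q"
    and fac: "\<And>u v. u \<in> gram_index r n d \<Longrightarrow> v \<in> gram_index r n d \<Longrightarrow>
      gram_entry n d Q u v = (\<Sum>k\<in>K. c k u * c k v)"
  shows "psd Q"
  unfolding psd_def
proof (intro conjI ballI)
  show "square_mat Q" "transpose_mat Q = Q" using Q by auto
  fix x :: "real vec" assume x: "x \<in> carrier_vec (dim_row Q)"
  let ?L = "r * monom_count n d" and ?I = "gram_index r n d"
  define y where "y u = x $ gram_pos n d u" for u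
  have "x \<bullet> (Q *\<^sub>v x) = (\<Sum>u<?L. x $ u * (\<Sum>v<?L. Q $$ (u, v) * x $ v))"
    using x Q(1) by (simp add: scalar_prod_def lessThan_atLeast0)
  also have "\<dots> = (\<Sum>u\<in>?I. \<Sum>v\<in>?I. y u * (gram_entry n d Q u v * y v))"
    unfolding sum_gram_index y_def gram_entry_def by (simp add: sum_distrib_left)
  also have "\<dots> = (\<Sum>u\<in>?I. \<Sum>v\<in>?I. \<Sum>k\<in>K. (y u * c k u) * (y v * c k v))"
    by (intro sum.cong refl) (simp add: fac sum_distrib_left sum_distrib_right mult_ac)
  also have "\<dots> = (\<Sum>u\<in>?I. \<Sum>k\<in>K. \<Sum>v\<in>?I. (y u * c k u) * (y v * c k v))"
    by (intro sum.cong refl sum.swap)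
  also have "\<dots> = (\<Sum>k\<in>K. \<Sum>u\<in>?I. \<Sum>v\<in>?I. (y u * c k u) * (y v * c k v))"
    by (rule sum.swap)
  also have "\<dots> = (\<Sum>k\<in>K. (\<Sum>u\<in>?I. y u * c k u)\<^sup>2)"
    by (simp add: power2_eq_square sum_product)
  also have "\<dots> \<ge> 0" by (simp add: sum_nonneg)
  finally show "x \<bullet> (Q *\<^sub>v x) \<ge> 0" .
qed

lemma const_mat_kron_poly_mats:
  assumes C: "C \<in> carrier_mat s (r * monom_count n d)"
  shows "const_mat C * monom_kron r n d \<in> poly_mats s r n d"
proof -
  have "(const_mat C * monom_kron r n d) $$ (k, j) \<in> polys n d" if "k < s" "j < r" for k j
    unfolding polys_def
  proof safe
    fix m assume "m \<in> Poly_Mapping.keys ((const_mat C * monom_kron r n d) $$ (k, j))"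
    then have "(\<Sum>p\<in>monoms n d. (C $$ (k, gram_pos n d (j, p)) when p = m)) \<noteq> 0"
      by (simp add: const_mat_kron_entry[OF C that] in_keys_iff lookup_sum lookup_single)
    then show "m \<in> monoms n d"
      by (metis (mono_tags, lifting) sum.neutral when_neq_zero)
  qed
  then show ?thesis
    using const_mat_carrier[OF C] monom_kron_carrier[of r n d] by (auto simp: poly_mats_def)
qed

text \<open>Reassociating \<open>(C V)^T (C V)\<close> as \<open>V^T (C^T C) V\<close>, where
  \<open>V\<close> is the Kronecker factor, exhibits \<open>C^T C\<close> as a Gram matrix.\<close>

lemma gram_of_factorization:
  assumes C: "C \<in> carrier_mat s (r * monom_count n d)"
  shows "gram_matrix r n d
    (transpose_mat (const_mat C * monom_kron r n d) * (const_mat C * monom_kron r n d))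
    (transpose_mat C * C)"
proof -
  let ?K = "monom_kron r n d" and ?L = "r * monom_count n d"
  note K = monom_kron_carrier[of r n d] and C' = const_mat_carrier[OF C]
  have "transpose_mat (const_mat C * ?K) * (const_mat C * ?K) =
      transpose_mat ?K * transpose_mat (const_mat C) * (const_mat C * ?K)"
    by (subst transpose_mult[OF C' K]) simp
  also have "\<dots> = transpose_mat ?K * (transpose_mat (const_mat C) * (const_mat C * ?K))"
    by (rule assoc_mult_mat[where ?n\<^sub>2.0 = ?L and ?n\<^sub>3.0 = s]) (use K C' in auto)
  also have "transpose_mat (const_mat C) * (const_mat C * ?K) =
      transpose_mat (const_mat C) * const_mat C * ?K"
    by (rule assoc_mult_mat[symmetric]) (use K C' in auto)
  also have "transpose_mat (const_mat C) * const_mat C = const_mat (transpose_mat C * C)"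
    using const_mat_mult[of "transpose_mat C" ?L s C ?L] C by (simp add: const_mat_transpose)
  also have "transpose_mat ?K * (const_mat (transpose_mat C * C) * ?K) =
      transpose_mat ?K * const_mat (transpose_mat C * C) * ?K"
    by (rule assoc_mult_mat[symmetric, where ?n\<^sub>2.0 = ?L and ?n\<^sub>3.0 = ?L])
      (use K C in \<open>auto intro!: const_mat_carrier\<close>)
  finally show ?thesis
    using C by (simp add: gram_matrix_def transpose_mult[of _ _ s])
qed

lemma factorization_entry:
  assumes C: "C \<in> carrier_mat s (r * monom_count n d)"
    and "u \<in> gram_index r n d" "v \<in> gram_index r n d"
  shows "gram_entry n d (transpose_mat C * C) u v =
    (\<Sum>k<s. C $$ (k, gram_pos n d u) * C $$ (k, gram_pos n d v))"
  using C gram_pos_less[OF assms(2)] gram_pos_less[OF assms(3)]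
  by (simp add: gram_entry_def scalar_prod_def lessThan_atLeast0)

text \<open>The vectors \<open>c k\<close> are the rows of a matrix \<open>C\<close> with
  \<open>C^T C = Q\<close>, and \<open>C\<close> times the Kronecker factor is the required
  polynomial factor.\<close>

lemma gram_factor_SOS:
  assumes G: "gram_matrix r n d P Q" and "finite K"
    and fac: "\<And>u v. u \<in> gram_index r n d \<Longrightarrow> v \<in> gram_index r n d \<Longrightarrow>
      gram_entry n d Q u v = (\<Sum>k\<in>K. c k u * c k v)"
  shows "P \<in> SOS r n d"
proof -
  let ?L = "r * monom_count n d"
  \<comment> \<open>Rows of a matrix are numbered, so \<open>K\<close> is enumerated first.\<close>
  obtain s :: nat and h where h: "bij_betw h {..<s} K"
    using ex_bij_betw_nat_finite[OF \<open>finite K\<close>] by (auto simp: lessThan_atLeast0)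
  define C where "C = mat s ?L (\<lambda>(k, u). c (h k) (gram_label n d u))"
  have C: "C \<in> carrier_mat s ?L" by (simp add: C_def)
  have "transpose_mat C * C = Q"
  proof (rule eq_matI)
    fix u v assume "u < dim_row Q" "v < dim_col Q"
    then have uv: "u < ?L" "v < ?L" using gram_matrixD(1)[OF G] by auto
    have "(transpose_mat C * C) $$ (u, v) = gram_entry n d (transpose_mat C * C)
       (gram_label n d u) (gram_label n d v)"
      by (simp add: gram_entry_label)
    also have "\<dots> = (\<Sum>k<s. c (h k) (gram_label n d u) * c (h k) (gram_label n d v))"
      unfolding factorization_entry[OF C gram_label_in[OF uv(1)] gram_label_in[OF uv(2)]]
      using uv by (simp add: C_def gram_pos_label)
    also have "\<dots> = (\<Sum>k\<in>K. c k (gram_label n d u) * c k (gram_label n d v))"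
      by (rule sum.reindex_bij_betw[OF h])
    also have "\<dots> = Q $$ (u, v)"
      using fac[OF gram_label_in[OF uv(1)] gram_label_in[OF uv(2)]] by (simp add: gram_entry_label)
    finally show "(transpose_mat C * C) $$ (u, v) = Q $$ (u, v)" .
  qed (use C gram_matrixD(1)[OF G] in auto)
  then have "P = transpose_mat (const_mat C * monom_kron r n d) * (const_mat C * monom_kron r n d)"
    using gram_of_factorization[OF C] G by (simp add: gram_matrix_def)
  then show ?thesis
    using const_mat_kron_poly_mats[OF C] gram_matrix_sym_poly_mats[OF G] by (auto simp: SOS_def)
qed

section \<open>Sparsity of the Gram matrix and sparsity of the polynomial matrix\<close>

lemma sparse_mats_if_entries_zero:
  assumes G: "gram_matrix r n d P Q" and E: "sparsity_pattern r E"
    and zero: "\<And>u v. u \<in> gram_index r n d \<Longrightarrow> v \<in> gram_index r n d \<Longrightarrow>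
      (fst u, fst v) \<notin> star_pattern r E \<Longrightarrow> gram_entry n d Q u v = 0"
  shows "P \<in> sparse_mats r n (2 * d) E"
proof -
  have P0: "P $$ (i, j) = 0" if ij: "i < r" "j < r" "(i, j) \<notin> star_pattern r E" for i j
  proof (rule poly_mapping_eqI)
    fix m
    have "gram_entry n d Q (i, p) (j, q) = 0" if "p \<in> monoms n d" "q \<in> monoms n d" for p q
      using ij that by (intro zero) (simp_all add: gram_index_def)
    then show "Poly_Mapping.lookup (P $$ (i, j)) m = Poly_Mapping.lookup 0 m"
      unfolding gram_coeff[OF G ij(1,2)] by (simp cong: if_cong)
  qed
  have "(j, i) \<notin> star_pattern r E" if "(i, j) \<notin> star_pattern r E" for i j
    using that E by (auto simp: star_pattern_def sparsity_pattern_def sym_def)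
  then show ?thesis
    using P0 gram_matrix_sym_poly_mats[OF G] unfolding sparse_mats_def by blast
qed

lemma block_zero_iff:
  assumes "Q \<in> carrier_mat (r * monom_count n d) (r * monom_count n d)" "i < r" "j < r"
  shows "block (monom_count n d) Q i j = 0\<^sub>m (monom_count n d) (monom_count n d) \<longleftrightarrow>
    (\<forall>p\<in>monoms n d. \<forall>q\<in>monoms n d. gram_entry n d Q (i, p) (j, q) = 0)" (is "?L \<longleftrightarrow> ?R")
proof
  assume L: ?L
  show ?R
  proof (intro ballI)
    fix p q assume "p \<in> monoms n d" "q \<in> monoms n d"
    then obtain a b where ab: "a < monom_count n d" "p = monom_list n d ! a"
      "b < monom_count n d" "q = monom_list n d ! b"
      by (metis obtain_monom_index)
    have "block (monom_count n d) Q i j $$ (a, b) = 0" using L ab by simp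
    then show "gram_entry n d Q (i, p) (j, q) = 0"
      using ab by (simp add: block_def gram_entry_def gram_pos_nth)
  qed
next
  assume R: ?R
  show ?L
  proof (rule eq_matI)
    fix a b assume "a < dim_row (0\<^sub>m (monom_count n d) (monom_count n d) :: real mat)"
      "b < dim_col (0\<^sub>m (monom_count n d) (monom_count n d) :: real mat)"
    then have ab: "a < monom_count n d" "b < monom_count n d" by auto
    then show "block (monom_count n d) Q i j $$ (a, b) =
        0\<^sub>m (monom_count n d) (monom_count n d) $$ (a, b)"
      using R[rule_format, OF nth_in_monoms[OF ab(1)] nth_in_monoms[OF ab(2)]]
      by (simp add: block_def gram_entry_def gram_pos_nth)
  qed (simp_all add: block_def)
qed

text \<open>A single explicit factorization yields the positive semidefinite Gram matrix and the sum
  of squares together; vanishing entries outside the pattern yield both sparsity conditions.\<close>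

lemma SSOS_onI:
  assumes G: "gram_matrix r n d P Q" and E: "sparsity_pattern r E" and K: "finite K"
    and fac: "\<And>u v. u \<in> gram_index r n d \<Longrightarrow> v \<in> gram_index r n d \<Longrightarrow>
      gram_entry n d Q u v = (\<Sum>k\<in>K. c k u * c k v)"
    and zero: "\<And>u v. u \<in> gram_index r n d \<Longrightarrow> v \<in> gram_index r n d \<Longrightarrow>
      (fst u, fst v) \<notin> star_pattern r E \<Longrightarrow> gram_entry n d Q u v = 0"
  shows "P \<in> SSOS_on r n d E"
proof -
  note D = gram_matrixD[OF G]
  have "psd Q" using D(1,2) fac by (rule gram_factor_psd)
  moreover have "block (monom_count n d) Q i j = 0\<^sub>m (monom_count n d) (monom_count n d)"
    if "i < r" "j < r" "(i, j) \<notin> star_pattern r E" for i j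
    unfolding block_zero_iff[OF D(1) that(1,2)]
    using that by (intro ballI zero) (simp_all add: gram_index_def)
  moreover have "P \<in> SOS_on r n d E"
    unfolding SOS_on_def using gram_factor_SOS[OF G K fac] sparse_mats_if_entries_zero[OF G E zero] by blast
  ultimately show ?thesis
    using G unfolding SSOS_on_def by blast
qed

subsection \<open>Diagonal dominance\<close>

lemma diagonal_quadratic_form:
  fixes D :: "real mat"
  assumes D: "D \<in> carrier_mat k k" "diagonal_mat D" and x: "x \<in> carrier_vec k"
  shows "x \<bullet> (D *\<^sub>v x) = (\<Sum>u<k. D $$ (u, u) * (x $ u)\<^sup>2)"
proof -
  have "x \<bullet> (D *\<^sub>v x) = (\<Sum>u<k. x $ u * (\<Sum>v<k. D $$ (u, v) * x $ v))"
    using D x by (simp add: scalar_prod_def lessThan_atLeast0)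
  also have "\<dots> = (\<Sum>u<k. x $ u * (\<Sum>v<k. if v = u then D $$ (u, v) * x $ v else 0))"
    using D by (intro sum.cong refl arg_cong2[of _ _ _ _ "(*)"]) (auto simp: diagonal_mat_def)
  finally show ?thesis by (simp add: power2_eq_square mult_ac)
qed

lemma pos_def_diagonal_iff:
  fixes D :: "real mat"
  assumes D: "D \<in> carrier_mat k k" "diagonal_mat D"
  shows "pos_def D \<longleftrightarrow> (\<forall>u<k. 0 < D $$ (u, u))"
proof
  assume pos: "pos_def D"
  show "\<forall>u<k. 0 < D $$ (u, u)"
  proof (intro allI impI)
    fix u assume u: "u < k"
    have x: "(unit_vec k u :: real vec) \<in> carrier_vec k" "(unit_vec k u :: real vec) \<noteq> 0\<^sub>v k"
      using u by auto
    then have "0 < unit_vec k u \<bullet> (D *\<^sub>v unit_vec k u)"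
      using pos D by (auto simp: pos_def_def)
    also have "\<dots> = (\<Sum>v<k. if v = u then D $$ (v, v) else 0)"
      unfolding diagonal_quadratic_form[OF D x(1)] using u by (intro sum.cong) auto
    finally show "0 < D $$ (u, u)" using u by simp
  qed
next
  assume pos: "\<forall>u<k. 0 < D $$ (u, u)"
  have "transpose_mat D = D"
  proof (rule eq_matI)
    fix i j assume "i < dim_row D" "j < dim_col D"
    then show "transpose_mat D $$ (i, j) = D $$ (i, j)"
      using D by (cases "i = j") (auto simp: diagonal_mat_def)
  qed (use D in auto)
  moreover have "0 < x \<bullet> (D *\<^sub>v x)" if x: "x \<in> carrier_vec k" and "x \<noteq> 0\<^sub>v k" for x
  proof -
    have "\<exists>u<k. x $ u \<noteq> 0"
    proof (rule ccontr)
      assume "\<not> ?thesis"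
      then have "x = 0\<^sub>v k" using x by (intro eq_vecI) auto
      with that(2) show False by contradiction
    qed
    then obtain u where u: "u < k" "x $ u \<noteq> 0" by blast
    show ?thesis
      unfolding diagonal_quadratic_form[OF D x]
      by (rule sum_pos2[of _ u]) (use u pos in \<open>auto simp: less_imp_le\<close>)
  qed
  ultimately show "pos_def D" using D by (auto simp: pos_def_def)
qed

lemma diagonal_scaling_entry:
  fixes A D :: "real mat"
  assumes A: "A \<in> carrier_mat k k" and D: "D \<in> carrier_mat k k" "diagonal_mat D"
    and uv: "u < k" "v < k"
  shows "(D * A * D) $$ (u, v) = D $$ (u, u) * A $$ (u, v) * D $$ (v, v)"
proof -
  have DA: "(D * A) $$ (u, w) = D $$ (u, u) * A $$ (u, w)" if "w < k" for w
  proof -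
    have "(D * A) $$ (u, w) = (\<Sum>t<k. if t = u then D $$ (u, t) * A $$ (t, w) else 0)"
      unfolding mult_mat_entry[OF D(1) A uv(1) that]
      using D uv by (intro sum.cong) (auto simp: diagonal_mat_def)
    then show ?thesis using uv by simp
  qed
  have "(D * A * D) $$ (u, v) = (\<Sum>w<k. if w = v then (D * A) $$ (u, w) * D $$ (w, v) else 0)"
    unfolding mult_mat_entry[OF mult_carrier_mat[OF D(1) A] D(1) uv]
    using D uv by (intro sum.cong) (auto simp: diagonal_mat_def)
  then show ?thesis using uv by (simp add: DA)
qed

text \<open>Row \<open>u\<close> of the dominance condition for \<open>D A D\<close> has the common
  factor \<open>D_uu > 0\<close>. Cancelling it leaves a condition with one positive weight per
  index, the diagonal of \<open>D\<close>.\<close>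

lemma scaled_diag_dominant_iff:
  assumes A: "A \<in> carrier_mat k k" "transpose_mat A = A"
  shows "scaled_diag_dominant A \<longleftrightarrow> (\<exists>\<delta>. (\<forall>u<k. 0 < \<delta> u) \<and>
    (\<forall>u<k. (\<Sum>v\<in>{..<k} - {u}. \<delta> v * \<bar>A $$ (u, v)\<bar>) \<le> \<delta> u * A $$ (u, u)))"
proof -
  \<comment> \<open>For a fixed diagonal \<open>D\<close>; if some diagonal entry is not positive,
    both sides fail.\<close>
  have key: "pos_def D \<and> diag_dominant (D * A * D) \<longleftrightarrow> (\<forall>u<k. 0 < D $$ (u, u)) \<and>
      (\<forall>u<k. (\<Sum>v\<in>{..<k} - {u}. D $$ (v, v) * \<bar>A $$ (u, v)\<bar>) \<le> D $$ (u, u) * A $$ (u, u))"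
    if D: "D \<in> carrier_mat k k" "diagonal_mat D" for D
  proof (cases "\<forall>u<k. 0 < D $$ (u, u)")
    case True
    have "A $$ (v, u) = A $$ (u, v)" if "u < k" "v < k" for u v
      using A that by (metis carrier_matD index_transpose_mat(1))
    then have "(D * A * D) $$ (v, u) = (D * A * D) $$ (u, v)" if "u < k" "v < k" for u v
      using that by (simp only: diagonal_scaling_entry[OF A(1) D] mult_ac)
    then have "transpose_mat (D * A * D) = D * A * D"
      using A D by (intro eq_matI) (simp_all del: index_mult_mat(1) assoc_mult_mat)
    moreover have "(\<Sum>v\<in>{..<k} - {u}. \<bar>(D * A * D) $$ (u, v)\<bar>) \<le> (D * A * D) $$ (u, u) \<longleftrightarrow>
        (\<Sum>v\<in>{..<k} - {u}. D $$ (v, v) * \<bar>A $$ (u, v)\<bar>) \<le> D $$ (u, u) * A $$ (u, u)"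
      if u: "u < k" for u
    proof -
      have "(\<Sum>v\<in>{..<k} - {u}. \<bar>(D * A * D) $$ (u, v)\<bar>) =
          D $$ (u, u) * (\<Sum>v\<in>{..<k} - {u}. D $$ (v, v) * \<bar>A $$ (u, v)\<bar>)"
        unfolding sum_distrib_left
      proof (intro sum.cong refl)
        fix v assume "v \<in> {..<k} - {u}"
        then have v: "v < k" by simp
        have "0 < D $$ (u, u)" "0 < D $$ (v, v)" using True u v by blast+
        then show "\<bar>(D * A * D) $$ (u, v)\<bar> = D $$ (u, u) * (D $$ (v, v) * \<bar>A $$ (u, v)\<bar>)"
          unfolding diagonal_scaling_entry[OF A(1) D u v] by (simp add: abs_mult)
      qed
      moreover have "(D * A * D) $$ (u, u) = D $$ (u, u) * (D $$ (u, u) * A $$ (u, u))"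
        by (simp add: diagonal_scaling_entry[OF A(1) D u u])
      ultimately show ?thesis
        using True u by simp
    qed
    ultimately show ?thesis
      using True D A unfolding pos_def_diagonal_iff[OF D] by (simp add: diag_dominant_def)
  next
    case False
    then show ?thesis unfolding pos_def_diagonal_iff[OF D] by blast
  qed
  show ?thesis
  proof
    assume "scaled_diag_dominant A"
    then obtain D where D: "D \<in> carrier_mat k k" "diagonal_mat D"
      and "pos_def D \<and> diag_dominant (D * A * D)"
      using A by (auto simp: scaled_diag_dominant_def)
    then show "\<exists>\<delta>. (\<forall>u<k. 0 < \<delta> u) \<and>
        (\<forall>u<k. (\<Sum>v\<in>{..<k} - {u}. \<delta> v * \<bar>A $$ (u, v)\<bar>) \<le> \<delta> u * A $$ (u, u))"
      unfolding key[OF D] by (intro exI[of _ "\<lambda>u. D $$ (u, u)"])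
  next
    assume "\<exists>\<delta>. (\<forall>u<k. 0 < \<delta> u) \<and>
        (\<forall>u<k. (\<Sum>v\<in>{..<k} - {u}. \<delta> v * \<bar>A $$ (u, v)\<bar>) \<le> \<delta> u * A $$ (u, u))"
    then obtain \<delta> where \<delta>: "\<forall>u<k. 0 < \<delta> u"
      "\<forall>u<k. (\<Sum>v\<in>{..<k} - {u}. \<delta> v * \<bar>A $$ (u, v)\<bar>) \<le> \<delta> u * A $$ (u, u)"
      by blast
    define D where "D = mat k k (\<lambda>(u, v). if u = v then \<delta> u else 0)"
    have D: "D \<in> carrier_mat k k" "diagonal_mat D" by (auto simp: D_def diagonal_mat_def)
    have "pos_def D \<and> diag_dominant (D * A * D)"
      unfolding key[OF D] using \<delta> by (simp add: D_def)
    then show "scaled_diag_dominant A"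
      using D A by (auto simp: scaled_diag_dominant_def)
  qed
qed

section \<open>Dominance conditions in terms of labels\<close>

lemma sum_gram_index_others:
  assumes "u \<in> gram_index r n d"
  shows "(\<Sum>v\<in>{..<r * monom_count n d} - {gram_pos n d u}. f v) =
    (\<Sum>v\<in>gram_index r n d - {u}. f (gram_pos n d v))"
proof -
  have "bij_betw (gram_pos n d) (gram_index r n d - {u})
      ({..<r * monom_count n d} - {gram_pos n d u})"
    using bij_betw_DiffI[OF gram_pos_bij[of n d r] bij_betw_singletonI[of "gram_pos n d" u]] assms
      gram_pos_less[OF assms]
    by simp
  then show ?thesis by (rule sum.reindex_bij_betw[symmetric])
qed

lemma all_gram_index:
  "(\<forall>u<r * monom_count n d. f u) \<longleftrightarrow> (\<forall>u\<in>gram_index r n d. f (gram_pos n d u))"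
proof -
  have "(\<forall>u\<in>{..<r * monom_count n d}. f u) \<longleftrightarrow> (\<forall>u\<in>gram_index r n d. f (gram_pos n d u))"
    unfolding bij_betw_imp_surj_on[OF gram_pos_bij[of n d r], symmetric] by simp
  then show ?thesis by (simp only: Ball_def lessThan_iff)
qed

lemma gram_diag_dominant_iff:
  assumes "gram_matrix r n d P Q"
  shows "diag_dominant Q \<longleftrightarrow> (\<forall>u\<in>gram_index r n d.
    (\<Sum>v\<in>gram_index r n d - {u}. \<bar>gram_entry n d Q u v\<bar>) \<le> gram_entry n d Q u u)"
proof -
  note Q = gram_matrixD(1,2)[OF assms]
  have "diag_dominant Q \<longleftrightarrow> (\<forall>u<r * monom_count n d.
      (\<Sum>v\<in>{..<r * monom_count n d} - {u}. \<bar>Q $$ (u, v)\<bar>) \<le> Q $$ (u, u))"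
    using Q by (simp add: diag_dominant_def)
  then show ?thesis
    unfolding all_gram_index by (simp add: sum_gram_index_others gram_entry_def)
qed

lemma gram_scaled_diag_dominant_iff:
  assumes Q: "Q \<in> carrier_mat (r * monom_count n d) (r * monom_count n d)" "transpose_mat Q = Q"
  shows "scaled_diag_dominant Q \<longleftrightarrow> (\<exists>\<delta>. (\<forall>u\<in>gram_index r n d. 0 < \<delta> u) \<and>
    (\<forall>u\<in>gram_index r n d. (\<Sum>v\<in>gram_index r n d - {u}. \<delta> v * \<bar>gram_entry n d Q u v\<bar>) \<le>
      \<delta> u * gram_entry n d Q u u))" (is "_ \<longleftrightarrow> ?R")
proof -
  have "scaled_diag_dominant Q \<longleftrightarrow> (\<exists>\<delta>. (\<forall>u\<in>gram_index r n d. 0 < \<delta> (gram_pos n d u)) \<and>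
    (\<forall>u\<in>gram_index r n d. (\<Sum>v\<in>gram_index r n d - {u}. \<delta> (gram_pos n d v) *
      \<bar>gram_entry n d Q u v\<bar>) \<le> \<delta> (gram_pos n d u) * gram_entry n d Q u u))" (is "_ \<longleftrightarrow> ?L")
    unfolding scaled_diag_dominant_iff[OF Q] all_gram_index
    by (simp add: sum_gram_index_others gram_entry_def)
  also have "?L \<longleftrightarrow> ?R"
  proof
    assume ?L
    then obtain \<delta> where "(\<forall>u\<in>gram_index r n d. 0 < \<delta> (gram_pos n d u)) \<and>
    (\<forall>u\<in>gram_index r n d. (\<Sum>v\<in>gram_index r n d - {u}. \<delta> (gram_pos n d v) *
      \<bar>gram_entry n d Q u v\<bar>) \<le> \<delta> (gram_pos n d u) * gram_entry n d Q u u)" by blast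
    then show ?R by (intro exI[of _ "\<lambda>u. \<delta> (gram_pos n d u)"])
  next
    assume ?R
    then obtain \<delta> where \<delta>: "\<forall>u\<in>gram_index r n d. 0 < \<delta> u"
      "\<forall>u\<in>gram_index r n d. (\<Sum>v\<in>gram_index r n d - {u}. \<delta> v * \<bar>gram_entry n d Q u v\<bar>) \<le>
        \<delta> u * gram_entry n d Q u u" by blast
    \<comment> \<open>The matrix version weights positions, so the weights on labels are pulled back
      along \<open>gram_label\<close>.\<close>
    define \<gamma> where "\<gamma> k = \<delta> (gram_label n d k)" for k
    have \<gamma>: "\<gamma> (gram_pos n d u) = \<delta> u" if "u \<in> gram_index r n d" for u
      using gram_label_pos[OF that] by (simp add: \<gamma>_def)
    have "(\<Sum>v\<in>gram_index r n d - {u}. \<gamma> (gram_pos n d v) * \<bar>gram_entry n d Q u v\<bar>) =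
        (\<Sum>v\<in>gram_index r n d - {u}. \<delta> v * \<bar>gram_entry n d Q u v\<bar>)" for u
      by (intro sum.cong) (auto simp: \<gamma>)
    then show ?L
      using \<delta> by (intro exI[of _ \<gamma>]) (simp add: \<gamma>)
  qed
  finally show ?thesis .
qed

text \<open>Dominance is scaled dominance with all weights equal to \<open>1\<close>.\<close>

lemma DSOS_on_subset_SDSOS_on: "DSOS_on r n d E \<subseteq> SDSOS_on r n d E"
proof -
  have "scaled_diag_dominant Q" if "gram_matrix r n d P Q" "diag_dominant Q" for P Q
    unfolding gram_scaled_diag_dominant_iff[OF gram_matrixD(1,2)[OF that(1)]]
    using that(2)[unfolded gram_diag_dominant_iff[OF that(1)]]
    by (intro exI[of _ "\<lambda>_. 1"]) simp
  then show ?thesis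
    unfolding DSOS_on_def SDSOS_on_def DSOS_def SDSOS_def by blast
qed

text \<open>Each ordered pair \<open>(u, v)\<close> of distinct indices contributes a vector
  supported on \<open>u\<close> and \<open>v\<close> that produces half of \<open>A u v\<close>.
  Together \<open>(u, v)\<close> and \<open>(v, u)\<close> use up
  \<open>\<delta> v * \<bar>A u v\<bar> / \<delta> u\<close> of the diagonal at \<open>u\<close>;
  dominance leaves a nonnegative remainder, which the pairs \<open>(u, u)\<close> supply.\<close>

lemma scaled_dominance_imp_rank_ones:
  fixes A :: "'a \<Rightarrow> 'a \<Rightarrow> real"
  assumes I: "finite I" and sym: "\<And>u v. u \<in> I \<Longrightarrow> v \<in> I \<Longrightarrow> A u v = A v u"
    and pos: "\<And>u. u \<in> I \<Longrightarrow> 0 < \<delta> u"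
    and dom: "\<And>u. u \<in> I \<Longrightarrow> (\<Sum>v\<in>I - {u}. \<delta> v * \<bar>A u v\<bar>) \<le> \<delta> u * A u u"
  shows "\<exists>c. \<forall>a\<in>I. \<forall>b\<in>I. A a b = (\<Sum>k\<in>I \<times> I. c k a * c k b)"
proof -
  \<comment> \<open>\<open>x\<close> and \<open>y\<close> are the entries at the first and second
    index of a pair. The weights split the diagonal unevenly between them, while the product
    \<open>x u v * y u v\<close> stays \<open>A u v / 2\<close>.\<close>
  define x where "x u v = (if u = v then sqrt (A u u - (\<Sum>w\<in>I - {u}. \<delta> w * \<bar>A u w\<bar> / \<delta> u))
    else sqrt (\<bar>A u v\<bar> * \<delta> v / (2 * \<delta> u)))" for u v
  define y where "y u v = (if u = v then 0 else sgn (A u v) * sqrt (\<bar>A u v\<bar> * \<delta> u / (2 * \<delta> v)))" for u v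
  \<comment> \<open>For a pair \<open>(u, u)\<close> both summands apply at \<open>u\<close>, which
    is harmless because \<open>y u u = 0\<close>.\<close>
  define c where "c k a = (if a = fst k then x (fst k) (snd k) else 0) +
    (if a = snd k then y (fst k) (snd k) else 0)" for k a
  have x2: "(x u v)\<^sup>2 = \<bar>A u v\<bar> * \<delta> v / (2 * \<delta> u)"
    and y2: "(y u v)\<^sup>2 = \<bar>A u v\<bar> * \<delta> u / (2 * \<delta> v)"
    and xy: "x u v * y u v = A u v / 2" if "u \<in> I" "v \<in> I" "u \<noteq> v" for u v
  proof -
    note p = pos[OF that(1)] pos[OF that(2)]
    show "(x u v)\<^sup>2 = \<bar>A u v\<bar> * \<delta> v / (2 * \<delta> u)"
      using that p by (simp add: x_def)
    show "(y u v)\<^sup>2 = \<bar>A u v\<bar> * \<delta> u / (2 * \<delta> v)"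
      using that p by (cases "A u v = 0") (simp_all add: y_def power_mult_distrib sgn_if)
    have "sqrt (\<bar>A u v\<bar> * \<delta> v / (2 * \<delta> u)) * sqrt (\<bar>A u v\<bar> * \<delta> u / (2 * \<delta> v)) =
        sqrt ((\<bar>A u v\<bar> / 2)\<^sup>2)"
      unfolding real_sqrt_mult[symmetric] using p
      by (intro arg_cong[of _ _ sqrt]) (simp add: field_simps power2_eq_square)
    then have "sgn (A u v) * (sqrt (\<bar>A u v\<bar> * \<delta> v / (2 * \<delta> u)) *
        sqrt (\<bar>A u v\<bar> * \<delta> u / (2 * \<delta> v))) = A u v / 2"
      by (simp only: real_sqrt_abs) (simp add: mult_sgn_abs)
    then show "x u v * y u v = A u v / 2"
      using that by (simp add: x_def y_def mult.left_commute)
  qed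
  have xd: "(x u u)\<^sup>2 = A u u - (\<Sum>w\<in>I - {u}. \<delta> w * \<bar>A u w\<bar> / \<delta> u)" if "u \<in> I" for u
  proof -
    have "(\<Sum>w\<in>I - {u}. \<delta> w * \<bar>A u w\<bar> / \<delta> u) \<le> A u u"
      using dom[OF that] pos[OF that] by (simp add: sum_divide_distrib[symmetric] divide_le_eq mult_ac)
    then show ?thesis by (simp add: x_def)
  qed
  have yd: "y u u = 0" for u by (simp add: y_def)
  have fst_delta: "(\<Sum>u\<in>I. \<Sum>v\<in>I. if u = e then f u v else 0) = (\<Sum>v\<in>I. f e v)"
    if "e \<in> I" for e and f :: "'a \<Rightarrow> 'a \<Rightarrow> real"
  proof -
    have "(\<Sum>u\<in>I. \<Sum>v\<in>I. if u = e then f u v else 0) =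
        (\<Sum>u\<in>I. if u = e then \<Sum>v\<in>I. f u v else 0)"
      by (intro sum.cong) auto
    then show ?thesis using that I by simp
  qed
  have snd_delta: "(\<Sum>u\<in>I. \<Sum>v\<in>I. if v = e then f u v else 0) = (\<Sum>u\<in>I. f u e)"
    if "e \<in> I" for e and f :: "'a \<Rightarrow> 'a \<Rightarrow> real"
    using that I by simp
  have "A a b = (\<Sum>k\<in>I \<times> I. c k a * c k b)" if ab: "a \<in> I" "b \<in> I" for a b
  proof -
    have "(\<Sum>k\<in>I \<times> I. c k a * c k b) = (\<Sum>u\<in>I. \<Sum>v\<in>I. c (u, v) a * c (u, v) b)"
      by (simp add: sum.cartesian_product)
    \<comment> \<open>The four terms of the expanded product, with nested conditionals so that each
      double sum collapses at an index.\<close>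
    also have "\<dots> = (\<Sum>u\<in>I. \<Sum>v\<in>I. (if u = a then if a = b then (x u v)\<^sup>2 else 0 else 0) +
        (if u = a then if v = b then x u v * y u v else 0 else 0) +
        (if u = b then if v = a then x u v * y u v else 0 else 0) +
        (if v = a then if a = b then (y u v)\<^sup>2 else 0 else 0))"
    proof (intro sum.cong refl)
      fix u v
      show "c (u, v) a * c (u, v) b = (if u = a then if a = b then (x u v)\<^sup>2 else 0 else 0) +
        (if u = a then if v = b then x u v * y u v else 0 else 0) +
        (if u = b then if v = a then x u v * y u v else 0 else 0) +
        (if v = a then if a = b then (y u v)\<^sup>2 else 0 else 0)"
        by (cases "a = b"; cases "u = a"; cases "v = a"; cases "u = b"; cases "v = b")
          (simp_all add: c_def power2_eq_square algebra_simps)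
    qed
    also have "\<dots> = (if a = b then \<Sum>v\<in>I. (x a v)\<^sup>2 else 0) + x a b * y a b + x b a * y b a +
        (if a = b then \<Sum>u\<in>I. (y u a)\<^sup>2 else 0)"
      using I ab by (simp add: sum.distrib fst_delta snd_delta)
    also have "\<dots> = A a b"
    proof (cases "a = b")
      case False
      then show ?thesis using xy[OF ab] xy[OF ab(2,1)] sym[OF ab] by simp
    next
      case True
      have "(\<Sum>v\<in>I. (x a v)\<^sup>2) + (\<Sum>u\<in>I. (y u a)\<^sup>2) =
          (x a a)\<^sup>2 + (\<Sum>v\<in>I - {a}. (x a v)\<^sup>2 + (y v a)\<^sup>2)"
        using I ab by (simp add: sum.remove[of I a] yd sum.distrib)
      also have "(\<Sum>v\<in>I - {a}. (x a v)\<^sup>2 + (y v a)\<^sup>2) = (\<Sum>v\<in>I - {a}. \<delta> v * \<bar>A a v\<bar> / \<delta> a)"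
      proof (intro sum.cong refl)
        fix v assume v: "v \<in> I - {a}"
        then have "(x a v)\<^sup>2 = \<bar>A a v\<bar> * \<delta> v / (2 * \<delta> a)" "(y v a)\<^sup>2 = \<bar>A a v\<bar> * \<delta> v / (2 * \<delta> a)"
          using x2[of a v] y2[of v a] ab sym[of a v] by auto
        then show "(x a v)\<^sup>2 + (y v a)\<^sup>2 = \<delta> v * \<bar>A a v\<bar> / \<delta> a"
          using pos[OF ab(1)] by (simp add: field_simps)
      qed
      finally show ?thesis using True xd[OF ab(1)] by (simp add: yd)
    qed
    finally show ?thesis by simp
  qed
  then have "\<forall>a\<in>I. \<forall>b\<in>I. A a b = (\<Sum>k\<in>I \<times> I. c k a * c k b)"
    by simp
  then show ?thesis by (intro exI[of _ c])
qed

text \<open>Deleting the blocks outside the pattern leaves a Gram matrix of the same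
  \<open>P\<close>, since the corresponding entries of \<open>P\<close> vanish. Diagonal entries are
  kept and off-diagonal ones do not grow in absolute value, so the same weights remain
  valid.\<close>

lemma SDSOS_on_subset_SSOS_on:
  assumes E: "sparsity_pattern r E"
  shows "SDSOS_on r n d E \<subseteq> SSOS_on r n d E"
proof
  fix P assume "P \<in> SDSOS_on r n d E"
  then obtain Q where G: "gram_matrix r n d P Q" and sdd: "scaled_diag_dominant Q"
    and sparse: "P \<in> sparse_mats r n (2 * d) E"
    by (auto simp: SDSOS_on_def SDSOS_def)
  let ?I = "gram_index r n d" and ?Q = "gram_entry n d Q"
  note D = gram_matrixD[OF G]
  obtain \<delta> where pos: "\<forall>u\<in>?I. 0 < \<delta> u"
    and dom: "\<forall>u\<in>?I. (\<Sum>v\<in>?I - {u}. \<delta> v * \<bar>?Q u v\<bar>) \<le> \<delta> u * ?Q u u"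
    using sdd unfolding gram_scaled_diag_dominant_iff[OF D(1,2)] by blast
  define A where "A u v = (if (fst u, fst v) \<in> star_pattern r E then ?Q u v else 0)" for u v
  have star_sym: "(fst u, fst v) \<in> star_pattern r E \<longleftrightarrow> (fst v, fst u) \<in> star_pattern r E" for u v :: "nat \<times> monom"
    using E by (auto simp: star_pattern_def sparsity_pattern_def sym_def)
  have A_sym: "A u v = A v u" if "u \<in> ?I" "v \<in> ?I" for u v
    using gram_entry_sym[OF D(1,2) that] star_sym[of u v] by (simp add: A_def)
  have A_diag: "A u u = ?Q u u" if "u \<in> ?I" for u
    using gram_indexD(1)[OF that] by (simp add: A_def star_pattern_def)
  have A_dom: "(\<Sum>v\<in>?I - {u}. \<delta> v * \<bar>A u v\<bar>) \<le> \<delta> u * A u u" if u: "u \<in> ?I" for u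
  proof -
    have "(\<Sum>v\<in>?I - {u}. \<delta> v * \<bar>A u v\<bar>) \<le> (\<Sum>v\<in>?I - {u}. \<delta> v * \<bar>?Q u v\<bar>)"
      using pos by (intro sum_mono) (auto simp: A_def less_imp_le)
    also have "\<dots> \<le> \<delta> u * ?Q u u" using dom u by blast
    finally show ?thesis by (simp add: A_diag u)
  qed
  have "\<exists>c. \<forall>u\<in>?I. \<forall>v\<in>?I. A u v = (\<Sum>k\<in>?I \<times> ?I. c k u * c k v)"
  proof (rule scaled_dominance_imp_rank_ones[OF finite_gram_index A_sym])
    show "0 < \<delta> u" if "u \<in> ?I" for u using pos that by blast
    show "(\<Sum>v\<in>?I - {u}. \<delta> v * \<bar>A u v\<bar>) \<le> \<delta> u * A u u" if "u \<in> ?I" for u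
      by (rule A_dom[OF that])
  qed
  then obtain c where c: "\<forall>u\<in>?I. \<forall>v\<in>?I. A u v = (\<Sum>k\<in>?I \<times> ?I. c k u * c k v)" ..
  define Q' where "Q' = gram_of r n d A"
  have Q': "Q' \<in> carrier_mat (r * monom_count n d) (r * monom_count n d)" "transpose_mat Q' = Q'"
    unfolding Q'_def by (rule gram_of_carrier, rule gram_of_sym) (rule A_sym)
  have entry: "gram_entry n d Q' u v = A u v" if "u \<in> ?I" "v \<in> ?I" for u v
    unfolding Q'_def by (rule gram_entry_of[OF that])
  have "gram_matrix r n d P Q'"
  proof (rule gram_matrix_transfer[OF G Q'])
    fix i j m assume ij: "i < r" "j < r"
    have e: "gram_entry n d Q' (i, p) (j, q) = A (i, p) (j, q)"
      if "p \<in> monoms n d" "q \<in> monoms n d" for p q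
      using ij that by (intro entry) (simp_all add: gram_index_def)
    show "Poly_Mapping.lookup (P $$ (i, j)) m = (\<Sum>p\<in>monoms n d. \<Sum>q\<in>monoms n d.
        if p + q = m then gram_entry n d Q' (i, p) (j, q) else 0)"
    proof (cases "(i, j) \<in> star_pattern r E")
      case True
      then show ?thesis
        unfolding gram_coeff[OF G ij] by (intro sum.cong refl) (simp add: e A_def)
    next
      case False
      then have "P $$ (i, j) = 0" using sparse ij by (auto simp: sparse_mats_def)
      then show ?thesis using False by (simp add: e A_def cong: if_cong)
    qed
  qed
  then show "P \<in> SSOS_on r n d E"
    using E finite_cartesian_product[OF finite_gram_index finite_gram_index]
  proof (rule SSOS_onI)
    show "gram_entry n d Q' u v = (\<Sum>k\<in>?I \<times> ?I. c k u * c k v)" if "u \<in> ?I" "v \<in> ?I" for u v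
      using entry[OF that] c that by simp
    show "gram_entry n d Q' u v = 0"
      if "u \<in> ?I" "v \<in> ?I" "(fst u, fst v) \<notin> star_pattern r E" for u v
      using that by (simp add: entry A_def)
  qed
qed

subsection \<open>Sign functionals\<close>

text \<open>Dividing row \<open>u\<close> by \<open>\<delta> u\<close> and summing over the rows,
  the pair \<open>{u, v}\<close> carries the factor
  \<open>\<delta> v / \<delta> u + \<delta> u / \<delta> v\<close>, which is at least
  \<open>2\<close>. The weights thereby disappear from the bound.\<close>

lemma scaled_dominance_trace:
  fixes A :: "'a \<Rightarrow> 'a \<Rightarrow> real"
  assumes I: "finite I" and sym: "\<And>u v. u \<in> I \<Longrightarrow> v \<in> I \<Longrightarrow> A u v = A v u"
    and pos: "\<And>u. u \<in> I \<Longrightarrow> 0 < \<delta> u"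
    and dom: "\<And>u. u \<in> I \<Longrightarrow> (\<Sum>v\<in>I - {u}. \<delta> v * \<bar>A u v\<bar>) \<le> \<delta> u * A u u"
  shows "(\<Sum>u\<in>I. \<Sum>v\<in>I - {u}. \<bar>A u v\<bar>) \<le> (\<Sum>u\<in>I. A u u)"
proof -
  \<comment> \<open>The value zero on the diagonal lets the sums run over all of
    \<open>I \<times> I\<close>, where the two indices can be swapped.\<close>
  define F where "F u v = (if u = v then 0 else \<delta> v / \<delta> u * \<bar>A u v\<bar>)" for u v
  have row: "(\<Sum>v\<in>I. F u v) \<le> A u u" if u: "u \<in> I" for u
  proof -
    have "(\<Sum>v\<in>I. F u v) = (\<Sum>v\<in>I - {u}. \<delta> v * \<bar>A u v\<bar> / \<delta> u)"
      by (rule sum.mono_neutral_cong_right) (use I in \<open>auto simp: F_def\<close>)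
    also have "\<dots> \<le> A u u"
      using dom[OF u] pos[OF u] by (simp add: sum_divide_distrib[symmetric] divide_le_eq mult_ac)
    finally show ?thesis .
  qed
  have am_gm: "2 * \<bar>A u v\<bar> \<le> F u v + F v u" if "u \<in> I" "v \<in> I" "u \<noteq> v" for u v
  proof -
    note p = pos[OF that(1)] pos[OF that(2)]
    have "0 \<le> (\<delta> v - \<delta> u)\<^sup>2 / (\<delta> u * \<delta> v)" using p by simp
    also have "\<dots> = \<delta> v / \<delta> u + \<delta> u / \<delta> v - 2"
      using p by (simp add: field_simps power2_eq_square)
    finally have "2 * \<bar>A u v\<bar> \<le> (\<delta> v / \<delta> u + \<delta> u / \<delta> v) * \<bar>A u v\<bar>"
      by (intro mult_right_mono) auto
    then show ?thesis using that sym[OF that(1,2)] by (simp add: F_def distrib_right)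
  qed
  have "2 * (\<Sum>u\<in>I. \<Sum>v\<in>I - {u}. \<bar>A u v\<bar>) = (\<Sum>u\<in>I. \<Sum>v\<in>I - {u}. 2 * \<bar>A u v\<bar>)"
    by (simp add: sum_distrib_left)
  also have "\<dots> \<le> (\<Sum>u\<in>I. \<Sum>v\<in>I - {u}. F u v + F v u)"
    by (intro sum_mono am_gm) auto
  also have "\<dots> = (\<Sum>u\<in>I. \<Sum>v\<in>I. F u v + F v u)"
    using I by (intro sum.cong refl sum.mono_neutral_left) (auto simp: F_def)
  also have "\<dots> = (\<Sum>u\<in>I. \<Sum>v\<in>I. F u v) + (\<Sum>u\<in>I. \<Sum>v\<in>I. F v u)"
    by (simp add: sum.distrib)
  also have "(\<Sum>u\<in>I. \<Sum>v\<in>I. F v u) = (\<Sum>u\<in>I. \<Sum>v\<in>I. F u v)"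
    by (rule sum.swap)
  also have "(\<Sum>u\<in>I. \<Sum>v\<in>I. F u v) + (\<Sum>u\<in>I. \<Sum>v\<in>I. F u v) \<le> 2 * (\<Sum>u\<in>I. A u u)"
    using sum_mono[of I "\<lambda>u. \<Sum>v\<in>I. F u v" "\<lambda>u. A u u"] row by simp
  finally show ?thesis by simp
qed

text \<open>A linear functional on the coefficients of \<open>P\<close>. Since it does not depend on
  a choice of Gram matrix, its value computed from one Gram matrix restricts all others.\<close>

definition pairing :: "nat \<Rightarrow> nat \<Rightarrow> nat \<Rightarrow> (nat \<Rightarrow> nat \<Rightarrow> monom \<Rightarrow> real) \<Rightarrow> rpoly mat \<Rightarrow> real" where
  "pairing r n k \<epsilon> P =
     (\<Sum>i<r. \<Sum>j<r. \<Sum>m\<in>monoms n k. \<epsilon> i j m * Poly_Mapping.lookup (P $$ (i, j)) m)"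

lemma sum_gram_index_blocks:
  "(\<Sum>u\<in>gram_index r n d. f u) = (\<Sum>i<r. \<Sum>p\<in>monoms n d. f (i, p))"
  unfolding gram_index_def sum.cartesian_product by (intro sum.cong) auto

text \<open>The functional on \<open>P\<close> becomes the entrywise inner product of
  \<open>Q\<close> with a moment matrix, whose entries depend on the two monomials only through
  their product.\<close>

lemma gram_pairing:
  assumes G: "gram_matrix r n d P Q"
  shows "pairing r n (2 * d) \<epsilon> P = (\<Sum>u\<in>gram_index r n d. \<Sum>v\<in>gram_index r n d.
    \<epsilon> (fst u) (fst v) (snd u + snd v) * gram_entry n d Q u v)"
proof -
  let ?M = "monoms n d"
  have block: "(\<Sum>m\<in>monoms n (2 * d). \<epsilon> i j m * Poly_Mapping.lookup (P $$ (i, j)) m) =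
      (\<Sum>p\<in>?M. \<Sum>q\<in>?M. \<epsilon> i j (p + q) * gram_entry n d Q (i, p) (j, q))"
    if ij: "i < r" "j < r" for i j
  proof -
    let ?t = "\<lambda>m p q. if m = p + q then \<epsilon> i j m * gram_entry n d Q (i, p) (j, q) else 0"
    have "(\<Sum>m\<in>monoms n (2 * d). \<epsilon> i j m * Poly_Mapping.lookup (P $$ (i, j)) m) =
        (\<Sum>m\<in>monoms n (2 * d). \<Sum>p\<in>?M. \<Sum>q\<in>?M. ?t m p q)"
      unfolding gram_coeff[OF G ij] sum_distrib_left by (intro sum.cong refl) auto
    also have "\<dots> = (\<Sum>p\<in>?M. \<Sum>m\<in>monoms n (2 * d). \<Sum>q\<in>?M. ?t m p q)"
      by (rule sum.swap)
    also have "\<dots> = (\<Sum>p\<in>?M. \<Sum>q\<in>?M. \<Sum>m\<in>monoms n (2 * d). ?t m p q)"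
      by (intro sum.cong refl sum.swap)
    also have "\<dots> = (\<Sum>p\<in>?M. \<Sum>q\<in>?M. \<epsilon> i j (p + q) * gram_entry n d Q (i, p) (j, q))"
    proof (intro sum.cong refl)
      fix p q assume "p \<in> ?M" "q \<in> ?M"
      then have "p + q \<in> monoms n (2 * d)" using monoms_add[of p n d q d] by (simp add: mult_2)
      then show "(\<Sum>m\<in>monoms n (2 * d). ?t m p q) = \<epsilon> i j (p + q) * gram_entry n d Q (i, p) (j, q)"
        by (simp add: finite_monoms)
    qed
    finally show ?thesis .
  qed
  have "pairing r n (2 * d) \<epsilon> P =
      (\<Sum>i<r. \<Sum>j<r. \<Sum>p\<in>?M. \<Sum>q\<in>?M. \<epsilon> i j (p + q) * gram_entry n d Q (i, p) (j, q))"
    unfolding pairing_def by (intro sum.cong refl block) auto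
  also have "\<dots> = (\<Sum>i<r. \<Sum>p\<in>?M. \<Sum>j<r. \<Sum>q\<in>?M. \<epsilon> i j (p + q) * gram_entry n d Q (i, p) (j, q))"
    by (intro sum.cong refl sum.swap)
  also have "\<dots> = (\<Sum>u\<in>gram_index r n d. \<Sum>v\<in>gram_index r n d.
      \<epsilon> (fst u) (fst v) (snd u + snd v) * gram_entry n d Q u v)"
    by (simp add: sum_gram_index_blocks)
  finally show ?thesis .
qed

text \<open>A sign pattern on the coefficients that is \<open>1\<close> on squares of monomials in the diagonal
  entries lies in the dual cone of \<open>SDSOS\<close>: all principal minors of order at most two of the
  corresponding moment matrix are nonnegative.\<close>

lemma scaled_diag_dominant_pairing_nonneg:
  assumes G: "gram_matrix r n d P Q" and sdd: "scaled_diag_dominant Q"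
    and bound: "\<And>i j m. \<bar>\<epsilon> i j m\<bar> \<le> 1" and square: "\<And>i p. \<epsilon> i i (p + p) = 1"
  shows "0 \<le> pairing r n (2 * d) \<epsilon> P"
proof -
  let ?I = "gram_index r n d" and ?Q = "gram_entry n d Q"
  let ?e = "\<lambda>u v. \<epsilon> (fst u) (fst v) (snd u + snd v)"
  note D = gram_matrixD(1,2)[OF G]
  obtain \<delta> where pos: "\<forall>u\<in>?I. 0 < \<delta> u"
    and dom: "\<forall>u\<in>?I. (\<Sum>v\<in>?I - {u}. \<delta> v * \<bar>?Q u v\<bar>) \<le> \<delta> u * ?Q u u"
    using sdd unfolding gram_scaled_diag_dominant_iff[OF D] by blast
  have "(\<Sum>u\<in>?I. \<Sum>v\<in>?I - {u}. \<bar>?Q u v\<bar>) \<le> (\<Sum>u\<in>?I. ?Q u u)"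
    by (rule scaled_dominance_trace[where \<delta> = \<delta>])
      (use finite_gram_index gram_entry_sym[OF D] pos dom in auto)
  then have "0 \<le> (\<Sum>u\<in>?I. ?Q u u + (\<Sum>v\<in>?I - {u}. - \<bar>?Q u v\<bar>))"
    by (simp add: sum_subtractf sum_negf)
  also have "\<dots> \<le> (\<Sum>u\<in>?I. ?Q u u + (\<Sum>v\<in>?I - {u}. ?e u v * ?Q u v))"
  proof (intro sum_mono add_mono order.refl)
    fix u v
    have "\<bar>?e u v * ?Q u v\<bar> \<le> 1 * \<bar>?Q u v\<bar>"
      unfolding abs_mult using bound by (intro mult_right_mono) auto
    then show "- \<bar>?Q u v\<bar> \<le> ?e u v * ?Q u v" by linarith
  qed
  also have "\<dots> = (\<Sum>u\<in>?I. \<Sum>v\<in>?I. ?e u v * ?Q u v)"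
    by (intro sum.cong refl) (simp add: sum.remove[OF finite_gram_index] square)
  also have "\<dots> = pairing r n (2 * d) \<epsilon> P"
    by (rule gram_pairing[OF G, symmetric])
  finally show ?thesis .
qed

text \<open>Row \<open>l\<close> of a factor \<open>C\<close> such that \<open>C\<^sup>T C\<close> is supported on the diagonal and the cycle
  \<open>0, 1, \<dots>, K + 1\<close>: as in sparse Cholesky elimination, the fill-in between \<open>l + 1\<close> and \<open>K + 1\<close>
  produced by row \<open>l\<close> is cancelled by row \<open>l + 1\<close>.\<close>

definition cycle_row :: "nat \<Rightarrow> nat \<Rightarrow> nat \<Rightarrow> real" where
  "cycle_row K l a = of_bool (a = l) - of_bool (a = Suc l) + of_bool (a = Suc K) / real K"

text \<open>The entries \<open>1\<close> and \<open>-1\<close> cancel, since \<open>Suc l\<close>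
  stays below the last index \<open>Suc K\<close>; only the last entry remains.\<close>

lemma cycle_row_sum:
  assumes "l < K"
  shows "(\<Sum>a<K + 2. cycle_row K l a) = 1 / real K"
  using assms by (simp add: cycle_row_def sum.distrib sum_subtractf of_bool_def
      sum_divide_distrib[symmetric])

text \<open>Index \<open>a\<close> meets row \<open>a\<close> with sign plus and row
  \<open>a - 1\<close> with sign minus. Both occur for \<open>0 < a < K\<close>, so the last index
  is joined only to its cycle neighbours \<open>0\<close> and \<open>K\<close>, positively to
  \<open>0\<close>.\<close>

lemma cycle_row_sum_last:
  assumes "a < Suc K"
  shows "(\<Sum>l<K. cycle_row K l a * cycle_row K l (Suc K)) =
    (of_bool (a < K) - of_bool (0 < a)) / real K"
proof -
  have "(\<Sum>l<K. cycle_row K l a * cycle_row K l (Suc K)) =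
      (\<Sum>l<K. (of_bool (a = l) - of_bool (a = Suc l)) / real K)"
    using assms by (intro sum.cong) (auto simp: cycle_row_def)
  also have "\<dots> = ((\<Sum>l<K. of_bool (a = l)) - (\<Sum>l<K. of_bool (a = Suc l))) / real K"
    by (simp add: sum_divide_distrib[symmetric] sum_subtractf)
  also have "(\<Sum>l<K. of_bool (a = l) :: real) = of_bool (a < K)"
    by (simp add: of_bool_def)
  also have "(\<Sum>l<K. of_bool (a = Suc l) :: real) = of_bool (0 < a)"
    using assms by (cases a) (simp_all add: of_bool_def)
  finally show ?thesis .
qed

text \<open>Apart from the last index, row \<open>l\<close> is supported on \<open>l\<close> and
  \<open>l + 1\<close>, so nonadjacent indices share no row; the last index is handled by the
  telescoping sum.\<close>

lemma cycle_gram_zero: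
  assumes "a < b" "b < K + 2" "b \<noteq> Suc a" "\<not> (a = 0 \<and> b = Suc K)"
  shows "(\<Sum>l<K. cycle_row K l a * cycle_row K l b) = 0"
proof (cases "b = Suc K")
  case True
  then show ?thesis using assms cycle_row_sum_last[of a K] by auto
next
  case False
  then show ?thesis using assms by (intro sum.neutral) (auto simp: cycle_row_def)
qed

text \<open>The functional changes the sign of the coefficient hit by the closing pair of the cycle.
  By \<open>nonsquare\<close> it is still \<open>1\<close> on squares; by \<open>unique\<close> no
  other pair of labels in \<open>us\<close> is affected. Its value drops from the entry sum
  \<open>1 / K\<close> to \<open>1 / K - 4 / K\<close>, which is negative.\<close>

lemma SDSOS_on_psubset_SSOS_on_of_cycle:
  assumes E: "sparsity_pattern r E" and K: "0 < K" and len: "length us = K + 2"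
    and dist: "distinct us" and us: "set us \<subseteq> gram_index r n d"
    and edges: "\<And>a. a < Suc K \<Longrightarrow> (fst (us ! a), fst (us ! Suc a)) \<in> star_pattern r E"
    and closing: "(fst (us ! 0), fst (us ! Suc K)) \<in> star_pattern r E"
    and nonsquare: "\<And>p. fst (us ! 0) = fst (us ! Suc K) \<Longrightarrow> p + p \<noteq> snd (us ! 0) + snd (us ! Suc K)"
    and unique: "\<And>a b. a < K + 2 \<Longrightarrow> b < K + 2 \<Longrightarrow> fst (us ! a) = fst (us ! 0) \<Longrightarrow>
      fst (us ! b) = fst (us ! Suc K) \<Longrightarrow> snd (us ! a) + snd (us ! b) = snd (us ! 0) + snd (us ! Suc K) \<Longrightarrow>
      a = 0 \<and> b = Suc K \<or> a = Suc K \<and> b = 0"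
  shows "SDSOS_on r n d E \<subset> SSOS_on r n d E"
proof -
  let ?I = "gram_index r n d"
  \<comment> \<open>The rows of the cycle factor, placed along \<open>us\<close> and extended by
    zero.\<close>
  define c where "c l u = (\<Sum>a<K + 2. if u = us ! a then cycle_row K l a else 0)" for l u
  define A where "A u v = (\<Sum>l<K. c l u * c l v)" for u v
  define g where "g a b = (\<Sum>l<K. cycle_row K l a * cycle_row K l b)" for a b
  have c_nth: "c l (us ! a) = cycle_row K l a" if a: "a < K + 2" for l a
  proof -
    have "c l (us ! a) = (\<Sum>b<K + 2. if b = a then cycle_row K l b else 0)"
      unfolding c_def using a len dist by (intro sum.cong refl) (simp add: nth_eq_iff_index_eq eq_commute)
    then show ?thesis using a by simp
  qed
  have c_zero: "c l u = 0" if "u \<notin> set us" for l u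
    using that len unfolding c_def by (intro sum.neutral) auto
  have A_nth: "A (us ! a) (us ! b) = g a b" if "a < K + 2" "b < K + 2" for a b
    using that by (simp add: A_def g_def c_nth)
  have A_zero: "A u v = 0" if "u \<notin> set us \<or> v \<notin> set us" for u v
    using that by (auto simp: A_def c_zero)
  have A_sym: "A u v = A v u" for u v by (simp add: A_def mult.commute)
  have star_sym: "(j, i) \<in> star_pattern r E" if "(i, j) \<in> star_pattern r E" for i j
    using that E by (auto simp: star_pattern_def sparsity_pattern_def sym_def)
  have sparse_lt: "A (us ! a) (us ! b) = 0"
    if "a < b" "b < K + 2" "(fst (us ! a), fst (us ! b)) \<notin> star_pattern r E" for a b
  proof -
    have "b \<noteq> Suc a" "\<not> (a = 0 \<and> b = Suc K)" using that edges[of a] closing by auto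
    then show ?thesis using that cycle_gram_zero[of a b K] by (simp add: A_nth g_def)
  qed
  have sparse: "A u v = 0" if uv: "u \<in> ?I" "v \<in> ?I" "(fst u, fst v) \<notin> star_pattern r E" for u v
  proof (cases "u \<in> set us \<and> v \<in> set us")
    case True
    then obtain a b where ab: "a < K + 2" "u = us ! a" "b < K + 2" "v = us ! b"
      using len by (metis in_set_conv_nth)
    have "fst u < r" using uv(1) by (rule gram_indexD)
    then have "a \<noteq> b" using uv(3) ab by (auto simp: star_pattern_def)
    then consider "a < b" | "b < a" by linarith
    then show ?thesis
    proof cases
      case 1
      then show ?thesis using sparse_lt[of a b] ab uv(3) by simp
    next
      case 2
      then show ?thesis using sparse_lt[of b a] star_sym[of "fst v" "fst u"] ab uv(3) A_sym[of u v] by auto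
    qed
  qed (use A_zero in blast)
  obtain P where G: "gram_matrix r n d P (gram_of r n d A)"
    using gram_matrix_of[of r n d A] A_sym by blast
  have entry: "gram_entry n d (gram_of r n d A) u v = A u v" if "u \<in> ?I" "v \<in> ?I" for u v
    by (rule gram_entry_of[OF that])
  have "P \<in> SSOS_on r n d E"
    using G E finite_lessThan[of K]
  proof (rule SSOS_onI)
    show "gram_entry n d (gram_of r n d A) u v = (\<Sum>l<K. c l u * c l v)" if "u \<in> ?I" "v \<in> ?I" for u v
      using entry[OF that] by (simp add: A_def)
    show "gram_entry n d (gram_of r n d A) u v = 0"
      if "u \<in> ?I" "v \<in> ?I" "(fst u, fst v) \<notin> star_pattern r E" for u v
      using entry[OF that(1,2)] sparse[OF that] by simp
  qed
  moreover have "P \<notin> SDSOS_on r n d E"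
  proof
    assume "P \<in> SDSOS_on r n d E"
    then obtain Q where Q: "gram_matrix r n d P Q" "scaled_diag_dominant Q"
      by (auto simp: SDSOS_on_def SDSOS_def)
    \<comment> \<open>Both orders of the closing pair are hit, in accordance with the symmetry of
      \<open>P\<close>.\<close>
    define hit where "hit i j m \<longleftrightarrow> m = snd (us ! 0) + snd (us ! Suc K) \<and>
      (i = fst (us ! 0) \<and> j = fst (us ! Suc K) \<or> i = fst (us ! Suc K) \<and> j = fst (us ! 0))" for i j m
    define \<epsilon> :: "nat \<Rightarrow> nat \<Rightarrow> monom \<Rightarrow> real" where "\<epsilon> i j m = (if hit i j m then -1 else 1)" for i j m
    have hit_nth: "hit (fst (us ! a)) (fst (us ! b)) (snd (us ! a) + snd (us ! b)) \<longleftrightarrow>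
        a = 0 \<and> b = Suc K \<or> a = Suc K \<and> b = 0" if "a < K + 2" "b < K + 2" for a b
      using unique[OF that] unique[OF that(2,1)]
      by (auto simp: hit_def add.commute)
    have "\<epsilon> i i (p + p) = 1" for i p
      using nonsquare[of p] by (auto simp: \<epsilon>_def hit_def)
    then have "0 \<le> pairing r n (2 * d) \<epsilon> P"
      using Q by (intro scaled_diag_dominant_pairing_nonneg) (auto simp: \<epsilon>_def)
    also have "\<dots> = (\<Sum>u\<in>?I. \<Sum>v\<in>?I. \<epsilon> (fst u) (fst v) (snd u + snd v) * A u v)"
      unfolding gram_pairing[OF G] by (intro sum.cong refl) (simp add: entry)
    also have "\<dots> = (\<Sum>u\<in>set us. \<Sum>v\<in>set us. \<epsilon> (fst u) (fst v) (snd u + snd v) * A u v)"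
    proof (rule sum.mono_neutral_cong_right[OF finite_gram_index us])
      show "\<forall>u\<in>?I - set us. (\<Sum>v\<in>?I. \<epsilon> (fst u) (fst v) (snd u + snd v) * A u v) = 0"
        by (simp add: A_zero)
      show "(\<Sum>v\<in>?I. \<epsilon> (fst u) (fst v) (snd u + snd v) * A u v) =
          (\<Sum>v\<in>set us. \<epsilon> (fst u) (fst v) (snd u + snd v) * A u v)" for u
        by (rule sum.mono_neutral_right[OF finite_gram_index us]) (simp add: A_zero)
    qed
    also have "\<dots> = (\<Sum>a<K + 2. \<Sum>b<K + 2. \<epsilon> (fst (us ! a)) (fst (us ! b))
        (snd (us ! a) + snd (us ! b)) * A (us ! a) (us ! b))"
    proof -
      have bij: "bij_betw ((!) us) {..<K + 2} (set us)"
        using dist len by (intro bij_betw_nth) auto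
      show ?thesis by (simp only: sum.reindex_bij_betw[OF bij, symmetric])
    qed
    \<comment> \<open>Changing the sign of an entry subtracts it twice.\<close>
    also have "\<dots> = (\<Sum>a<K + 2. \<Sum>b<K + 2. g a b - (if a = 0 then if b = Suc K then 2 * g a b else 0 else 0)
        - (if a = Suc K then if b = 0 then 2 * g a b else 0 else 0))"
      by (intro sum.cong refl) (simp add: \<epsilon>_def hit_nth A_nth)
    also have "\<dots> = (\<Sum>a<K + 2. (\<Sum>b<K + 2. g a b) - (if a = 0 then 2 * g 0 (Suc K) else 0)
        - (if a = Suc K then 2 * g (Suc K) 0 else 0))"
      using K by (intro sum.cong refl) (simp add: sum_subtractf)
    also have "\<dots> = (\<Sum>a<K + 2. \<Sum>b<K + 2. g a b) - 2 * g 0 (Suc K) - 2 * g (Suc K) 0"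
      by (simp add: sum_subtractf)
    \<comment> \<open>The sum of all entries of \<open>C^T C\<close> is the sum of the squared row
      sums of \<open>C\<close>: \<open>K\<close> terms, each \<open>1 / K^2\<close>.\<close>
    also have "(\<Sum>a<K + 2. \<Sum>b<K + 2. g a b) =
        (\<Sum>a<K + 2. \<Sum>l<K. \<Sum>b<K + 2. cycle_row K l a * cycle_row K l b)"
      unfolding g_def by (intro sum.cong refl sum.swap)
    also have "\<dots> = (\<Sum>l<K. \<Sum>a<K + 2. \<Sum>b<K + 2. cycle_row K l a * cycle_row K l b)"
      by (rule sum.swap)
    also have "\<dots> = (\<Sum>l<K. (\<Sum>a<K + 2. cycle_row K l a) * (\<Sum>b<K + 2. cycle_row K l b))"
      by (simp only: sum_product)
    also have "\<dots> = (\<Sum>l<K. 1 / real K * (1 / real K))"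
      by (intro sum.cong refl) (simp only: cycle_row_sum lessThan_iff)
    also have "\<dots> = 1 / real K" using K by simp
    also have "g (Suc K) 0 = g 0 (Suc K)" by (simp add: g_def mult.commute)
    also have "g 0 (Suc K) = 1 / real K"
      using K cycle_row_sum_last[of 0 K] by (simp add: g_def)
    finally show False using K by (simp add: field_simps)
  qed
  ultimately show ?thesis using SDSOS_on_subset_SSOS_on[OF E, of n d] by blast
qed

subsection \<open>Matrices separating the cones\<close>

lemma single_in_monoms: "k < n \<Longrightarrow> e \<le> d \<Longrightarrow> Poly_Mapping.single k e \<in> monoms n d"
  by (auto simp: monoms_def mdeg_single)

lemma single_1_nonzero: "Poly_Mapping.single k (1 :: nat) \<noteq> 0"
  by (metis lookup_single_eq lookup_zero zero_neq_one)

text \<open>Degrees add, so one of the two factors of a variable has degree zero.\<close>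

lemma add_eq_single_1_iff:
  fixes p q :: monom
  shows "p + q = Poly_Mapping.single k 1 \<longleftrightarrow>
    p = 0 \<and> q = Poly_Mapping.single k 1 \<or> p = Poly_Mapping.single k 1 \<and> q = 0"
proof
  assume eq: "p + q = Poly_Mapping.single k 1"
  have "mdeg p + mdeg q = 1"
    using arg_cong[OF eq, of mdeg] by (simp add: mdeg_add mdeg_single)
  then have "mdeg p = 0 \<or> mdeg q = 0" by linarith
  then have "p = 0 \<or> q = 0" by (simp only: mdeg_zero_iff)
  with eq show "p = 0 \<and> q = Poly_Mapping.single k 1 \<or> p = Poly_Mapping.single k 1 \<and> q = 0"
    by auto
qed auto

lemma add_eq_zero_iff_monom:
  fixes p q :: monom
  shows "p + q = 0 \<longleftrightarrow> p = 0 \<and> q = 0"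
proof
  assume eq: "p + q = 0"
  have "mdeg (p + q) = 0" using eq by (simp only: mdeg_zero_iff)
  then have "mdeg p + mdeg q = 0" by (simp only: mdeg_add)
  then show "p = 0 \<and> q = 0" by (simp add: mdeg_zero_iff)
qed simp

text \<open>The constant monomial factors only trivially, so \<open>P\<close> determines these Gram
  entries.\<close>

lemma gram_coeff_0:
  assumes G: "gram_matrix r n d P Q" and ij: "i < r" "j < r"
  shows "Poly_Mapping.lookup (P $$ (i, j)) 0 = gram_entry n d Q (i, 0) (j, 0)"
proof -
  have "Poly_Mapping.lookup (P $$ (i, j)) 0 = (\<Sum>p\<in>monoms n d. \<Sum>q\<in>monoms n d.
      if p = 0 then if q = 0 then gram_entry n d Q (i, 0) (j, 0) else 0 else 0)"
    unfolding gram_coeff[OF G ij] by (intro sum.cong refl) (auto simp: add_eq_zero_iff_monom)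
  also have "\<dots> = (\<Sum>p\<in>monoms n d. if p = 0 then gram_entry n d Q (i, 0) (j, 0) else 0)"
    by (intro sum.cong refl) (simp add: finite_monoms zero_in_monoms)
  finally show ?thesis by (simp add: finite_monoms zero_in_monoms)
qed

lemma gram_coeff_1:
  assumes G: "gram_matrix r n d P Q" and ij: "i < r" "j < r" and "k < n" "0 < d"
  defines "x \<equiv> Poly_Mapping.single k 1"
  shows "Poly_Mapping.lookup (P $$ (i, j)) x =
    gram_entry n d Q (i, 0) (j, x) + gram_entry n d Q (i, x) (j, 0)"
proof -
  have x: "x \<in> monoms n d" "x \<noteq> 0"
    using assms(4,5) single_1_nonzero[of k] by (simp_all add: x_def single_in_monoms)
  have add_x: "p + q = x \<longleftrightarrow> p = 0 \<and> q = x \<or> p = x \<and> q = 0" for p q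
    unfolding x_def by (rule add_eq_single_1_iff)
  have "Poly_Mapping.lookup (P $$ (i, j)) x = (\<Sum>p\<in>monoms n d. \<Sum>q\<in>monoms n d.
      (if p = 0 then if q = x then gram_entry n d Q (i, 0) (j, x) else 0 else 0) +
      (if p = x then if q = 0 then gram_entry n d Q (i, x) (j, 0) else 0 else 0))"
    unfolding gram_coeff[OF G ij]
    by (intro sum.cong refl) (use x in \<open>auto simp: add_x\<close>)
  also have "\<dots> = (\<Sum>p\<in>monoms n d. (if p = 0 then gram_entry n d Q (i, 0) (j, x) else 0) +
      (if p = x then gram_entry n d Q (i, x) (j, 0) else 0))"
    by (intro sum.cong refl) (use x in \<open>simp add: finite_monoms zero_in_monoms sum.distrib\<close>)
  finally show ?thesis using x by (simp add: finite_monoms zero_in_monoms sum.distrib)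
qed

text \<open>Row \<open>u\<close> of the rank-one example has diagonal entry \<open>1\<close> and an
  entry \<open>2\<close> beside it. By \<open>rigid\<close>, both persist in every Gram matrix of
  \<open>P\<close>, so none is diagonally dominant.\<close>

lemma DSOS_on_psubset_SDSOS_on_of_rigid_entry:
  assumes E: "sparsity_pattern r E" and uv: "u \<in> gram_index r n d" "v \<in> gram_index r n d" "u \<noteq> v"
    and edge: "(fst u, fst v) \<in> star_pattern r E"
    and rigid: "\<And>P Q Q'. gram_matrix r n d P Q \<Longrightarrow> gram_matrix r n d P Q' \<Longrightarrow>
      gram_entry n d Q' u u = gram_entry n d Q u u \<and> gram_entry n d Q' u v = gram_entry n d Q u v"
  shows "DSOS_on r n d E \<subset> SDSOS_on r n d E"
proof -
  let ?I = "gram_index r n d"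
  define c :: "nat \<times> monom \<Rightarrow> real" where "c w = (if w = u then 1 else if w = v then 2 else 0)" for w
  define A where "A a b = c a * c b" for a b
  have c: "c u = 1" "c v = 2" "\<And>w. w \<noteq> u \<Longrightarrow> w \<noteq> v \<Longrightarrow> c w = 0"
    using uv(3) by (auto simp: c_def)
  obtain P where G: "gram_matrix r n d P (gram_of r n d A)"
    using gram_matrix_of[of r n d A] by (auto simp: A_def mult.commute)
  have entry: "gram_entry n d (gram_of r n d A) a b = A a b" if "a \<in> ?I" "b \<in> ?I" for a b
    by (rule gram_entry_of[OF that])
  have star_sym: "(j, i) \<in> star_pattern r E" if "(i, j) \<in> star_pattern r E" for i j
    using that E by (auto simp: star_pattern_def sparsity_pattern_def sym_def)
  have sparse: "P \<in> sparse_mats r n (2 * d) E"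
  proof (rule sparse_mats_if_entries_zero[OF G E])
    fix a b assume ab: "a \<in> ?I" "b \<in> ?I" "(fst a, fst b) \<notin> star_pattern r E"
    have "a \<noteq> u \<and> a \<noteq> v \<or> b \<noteq> u \<and> b \<noteq> v"
      using ab(3) edge star_sym[OF edge] gram_indexD(1)[OF ab(1)] by (auto simp: star_pattern_def)
    then have "c a = 0 \<or> c b = 0" using c(3) by blast
    then show "gram_entry n d (gram_of r n d A) a b = 0"
      by (auto simp: entry ab A_def)
  qed
  have sdd: "scaled_diag_dominant (gram_of r n d A)"
    unfolding gram_scaled_diag_dominant_iff[OF gram_matrixD(1,2)[OF G]]
  \<comment> \<open>Weights \<open>2\<close> at \<open>u\<close> and \<open>1\<close> at
    \<open>v\<close> balance the entries \<open>1, 2, 4\<close>: the two rows give the equalities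
    \<open>2 = 2\<close> and \<open>4 = 4\<close>.\<close>
  proof (intro exI[of _ "\<lambda>w. if w = u then 2 else 1"] conjI ballI)
    fix a assume a: "a \<in> ?I"
    have "(\<Sum>b\<in>?I - {a}. (if b = u then 2 else 1) * \<bar>gram_entry n d (gram_of r n d A) a b\<bar>) =
        (\<Sum>b\<in>?I - {a}. (if b = u then 2 * \<bar>c a\<bar> else 0) + (if b = v then 2 * \<bar>c a\<bar> else 0))"
      by (intro sum.cong refl) (use a uv(3) c in \<open>auto simp: entry A_def abs_mult\<close>)
    also have "\<dots> \<le> (if a = u then 2 else 1) * gram_entry n d (gram_of r n d A) a a"
      using a uv finite_gram_index c
      by (cases "a = u"; cases "a = v") (auto simp: sum.distrib entry A_def)
    finally show "(\<Sum>b\<in>?I - {a}. (if b = u then 2 else 1) * \<bar>gram_entry n d (gram_of r n d A) a b\<bar>)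
        \<le> (if a = u then 2 else 1) * gram_entry n d (gram_of r n d A) a a" .
  qed simp
  have "P \<in> SDSOS_on r n d E"
    using G sdd sparse gram_matrix_sym_poly_mats[OF G] by (auto simp: SDSOS_on_def SDSOS_def)
  moreover have "P \<notin> DSOS_on r n d E"
  proof
    assume "P \<in> DSOS_on r n d E"
    then obtain Q where Q: "gram_matrix r n d P Q" "diag_dominant Q"
      by (auto simp: DSOS_on_def DSOS_def)
    have "\<bar>gram_entry n d Q u v\<bar> \<le> (\<Sum>w\<in>?I - {u}. \<bar>gram_entry n d Q u w\<bar>)"
      by (rule member_le_sum) (use uv finite_gram_index in auto)
    also have "\<dots> \<le> gram_entry n d Q u u"
      using Q uv(1) by (simp add: gram_diag_dominant_iff)
    finally show False
      using rigid[OF G Q(1)] by (simp add: entry uv A_def c)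
  qed
  ultimately show ?thesis using DSOS_on_subset_SDSOS_on[of r n d E] by blast
qed

lemma DSOS_on_psubset_SDSOS_on:
  assumes E: "sparsity_pattern r E" and nondeg: "r > 0 \<and> n > 0 \<and> d > 0 \<or> has_edge E"
  shows "DSOS_on r n d E \<subset> SDSOS_on r n d E"
  using nondeg
proof
  assume "has_edge E"
  then obtain i j where ij: "(i, j) \<in> E" "i \<noteq> j" by (auto simp: has_edge_def)
  then have r: "i < r" "j < r" using E by (auto simp: sparsity_pattern_def)
  show ?thesis
  proof (rule DSOS_on_psubset_SDSOS_on_of_rigid_entry[OF E, of "(i, 0)" n d "(j, 0)"])
    fix P Q Q' assume "gram_matrix r n d P Q" "gram_matrix r n d P Q'"
    then show "gram_entry n d Q' (i, 0) (i, 0) = gram_entry n d Q (i, 0) (i, 0) \<and>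
        gram_entry n d Q' (i, 0) (j, 0) = gram_entry n d Q (i, 0) (j, 0)"
      using r by (simp add: gram_coeff_0[symmetric])
  qed (use ij r in \<open>auto simp: gram_index_def star_pattern_def zero_in_monoms\<close>)
next
  assume pos: "r > 0 \<and> n > 0 \<and> d > 0"
  define x :: monom where "x = Poly_Mapping.single 0 1"
  have x: "x \<in> monoms n d" "x \<noteq> 0" using pos single_1_nonzero[of 0] by (simp_all add: x_def single_in_monoms)
  have idx: "(0, 0) \<in> gram_index r n d" "(0, x) \<in> gram_index r n d"
    using pos x by (auto simp: gram_index_def zero_in_monoms)
  \<comment> \<open>In a diagonal block symmetry identifies the two Gram entries that contribute to
    \<open>x\<close>, so the coefficient determines their common value.\<close>
  have twice: "Poly_Mapping.lookup (P $$ (0, 0)) x = 2 * gram_entry n d Q (0, 0) (0, x)"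
    if "gram_matrix r n d P Q" for P Q
    using gram_coeff_1[OF that, of 0 0 0] pos gram_entry_sym[OF gram_matrixD(1,2)[OF that] idx]
    by (simp add: x_def)
  show ?thesis
  proof (rule DSOS_on_psubset_SDSOS_on_of_rigid_entry[OF E, of "(0, 0)" n d "(0, x)"])
    fix P Q Q' assume G: "gram_matrix r n d P Q" "gram_matrix r n d P Q'"
    show "gram_entry n d Q' (0, 0) (0, 0) = gram_entry n d Q (0, 0) (0, 0) \<and>
        gram_entry n d Q' (0, 0) (0, x) = gram_entry n d Q (0, 0) (0, x)"
      using twice[OF G(1)] twice[OF G(2)] pos gram_coeff_0[OF G(1), of 0 0]
        gram_coeff_0[OF G(2), of 0 0] by simp
  qed (use idx x pos in \<open>auto simp: star_pattern_def\<close>)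
qed

text \<open>The coefficients of a factor \<open>M\<close> form a matrix \<open>C\<close> with Gram
  matrix \<open>C^T C\<close>. A full pattern leaves no pair of vertices at which a block would have
  to vanish.\<close>

lemma SSOS_on_eq_SOS_on_full:
  assumes E: "sparsity_pattern r E" and full: "full_pattern r E"
  shows "SSOS_on r n d E = SOS_on r n d E"
proof
  show "SOS_on r n d E \<subseteq> SSOS_on r n d E"
  proof
    fix P assume "P \<in> SOS_on r n d E"
    then obtain s M where M: "M \<in> poly_mats s r n d" and P: "P = transpose_mat M * M"
      by (auto simp: SOS_on_def SOS_def)
    let ?L = "r * monom_count n d"
    define C where "C = mat s ?L (\<lambda>(k, u).
      Poly_Mapping.lookup (M $$ (k, fst (gram_label n d u))) (snd (gram_label n d u)))"
    have C: "C \<in> carrier_mat s ?L" by (simp add: C_def)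
    have "const_mat C * monom_kron r n d = M"
    proof (rule eq_matI)
      fix k j assume "k < dim_row M" "j < dim_col M"
      then have kj: "k < s" "j < r" using M by (auto simp: poly_mats_def)
      have idx: "(j, p) \<in> gram_index r n d" if "p \<in> monoms n d" for p
        using that kj by (simp add: gram_index_def)
      have "(const_mat C * monom_kron r n d) $$ (k, j) =
          (\<Sum>p\<in>monoms n d. Poly_Mapping.single p (Poly_Mapping.lookup (M $$ (k, j)) p))"
        unfolding const_mat_kron_entry[OF C kj]
        by (intro sum.cong refl) (simp add: C_def kj gram_pos_less[OF idx] gram_label_pos[OF idx])
      also have "\<dots> = M $$ (k, j)"
      proof (rule poly_mapping_eqI)
        fix m
        have "Poly_Mapping.keys (M $$ (k, j)) \<subseteq> monoms n d"
          using M kj by (auto simp: poly_mats_def polys_def)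
        then have "m \<notin> monoms n d \<Longrightarrow> Poly_Mapping.lookup (M $$ (k, j)) m = 0"
          by (auto simp: in_keys_iff)
        then show "Poly_Mapping.lookup (\<Sum>p\<in>monoms n d.
            Poly_Mapping.single p (Poly_Mapping.lookup (M $$ (k, j)) p)) m =
            Poly_Mapping.lookup (M $$ (k, j)) m"
          by (simp add: lookup_sum lookup_single when_def finite_monoms)
      qed
      finally show "(const_mat C * monom_kron r n d) $$ (k, j) = M $$ (k, j)" .
    qed (use M const_mat_carrier[OF C] monom_kron_carrier[of r n d] in \<open>auto simp: poly_mats_def\<close>)
    then have G: "gram_matrix r n d P (transpose_mat C * C)"
      using gram_of_factorization[OF C] P by simp
    show "P \<in> SSOS_on r n d E"
      using G E finite_lessThan[of s] factorization_entry[OF C]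
    proof (rule SSOS_onI)
      fix u v assume "u \<in> gram_index r n d" "v \<in> gram_index r n d" "(fst u, fst v) \<notin> star_pattern r E"
      then show "gram_entry n d (transpose_mat C * C) u v = 0"
        using full gram_indexD(1)[of u r n d] gram_indexD(1)[of v r n d]
        by (auto simp: full_pattern_def star_pattern_def)
    qed
  qed
qed (auto simp: SSOS_on_def)

lemma SDSOS_on_psubset_SSOS_on:
  assumes E: "sparsity_pattern r E"
    and nondeg: "r > 0 \<and> n > 0 \<and> d > 0 \<and> (n > 1 \<or> d > 1 \<or> has_edge E) \<or> has_cycle E"
  shows "SDSOS_on r n d E \<subset> SSOS_on r n d E"
proof -
  define x :: monom where "x = Poly_Mapping.single 0 1"
  have add_x: "p + q = x \<longleftrightarrow> p = 0 \<and> q = x \<or> p = x \<and> q = 0" for p q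
    unfolding x_def by (rule add_eq_single_1_iff)
  have x0: "x \<noteq> 0" unfolding x_def by (rule single_1_nonzero)
  have not_double: "p + p \<noteq> x" for p
    using x0 by (auto simp: add_x)
  \<comment> \<open>The cycle \<open>1, p, x\<close> inside one diagonal block. Its closing product
    \<open>x\<close> is no square and arises from no other pair among the three.\<close>
  have univariate: ?thesis
    if pos: "0 < r" "0 < n" "0 < d" and p: "p \<in> monoms n d" "p \<noteq> 0" "p \<noteq> x" for p
  proof (rule SDSOS_on_psubset_SSOS_on_of_cycle[OF E, where K = 1 and us = "[(0, 0), (0, p), (0, x)]"])
    have "x \<in> monoms n d" using pos by (simp add: x_def single_in_monoms)
    then show "set [(0, 0), (0, p), (0, x)] \<subseteq> gram_index r n d"
      using pos p by (simp add: gram_index_def zero_in_monoms)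
    show "a = 0 \<and> b = Suc 1 \<or> a = Suc 1 \<and> b = 0"
      if "a < 1 + 2" "b < 1 + 2" "snd ([(0, 0), (0, p), (0, x)] ! a) + snd ([(0, 0), (0, p), (0, x)] ! b) =
        snd ([(0, 0), (0, p), (0, x)] ! 0) + snd ([(0, 0), (0, p), (0, x)] ! Suc 1)" for a b :: nat
    proof -
      have "a = 0 \<or> a = 1 \<or> a = 2" "b = 0 \<or> b = 1 \<or> b = 2" using that by auto
      then show ?thesis using that(3) x0 p by (elim disjE) (simp_all add: add_x)
    qed
  qed (use pos p x0 not_double in \<open>auto simp: star_pattern_def less_Suc_eq\<close>)
  consider (cycle) "has_cycle E" | (edge) "r > 0" "n > 0" "d > 0" "has_edge E"
    | (vars) "r > 0" "n > 1" "d > 0" | (degree) "r > 0" "n > 0" "d > 1"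
    using nondeg by auto
  then show ?thesis
  proof cases
    case cycle
    then obtain vs where vs: "3 \<le> length vs" "distinct vs"
      and cyc: "\<And>k. k < length vs \<Longrightarrow> (vs ! k, vs ! (Suc k mod length vs)) \<in> E"
      by (auto simp: has_cycle_def)
    \<comment> \<open>A cycle of length \<open>K + 2\<close> needs \<open>K\<close> rows in the
      factor, so a triangle has \<open>K = 1\<close>.\<close>
    define K where "K = length vs - 2"
    have len: "length vs = K + 2" and K: "0 < K" using vs(1) by (auto simp: K_def)
    define us :: "(nat \<times> monom) list" where "us = map (\<lambda>v. (v, 0)) vs"
    have nth: "us ! a = (vs ! a, 0)" if "a < K + 2" for a
      using that len by (simp add: us_def)
    have ends: "us ! 0 = (vs ! 0, 0)" "us ! Suc K = (vs ! Suc K, 0)" by (simp_all add: nth)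
    have index_eq: "vs ! a = vs ! b \<longleftrightarrow> a = b" if "a < K + 2" "b < K + 2" for a b
      using that vs(2) len by (simp add: nth_eq_iff_index_eq)
    show ?thesis
    proof (rule SDSOS_on_psubset_SSOS_on_of_cycle[OF E K, where us = us])
      show "length us = K + 2" by (simp add: us_def len)
      show "distinct us" using vs(2) by (simp add: us_def distinct_map inj_on_def)
      have "v < r" if "v \<in> set vs" for v
        using that cyc E by (auto simp: in_set_conv_nth sparsity_pattern_def)
      then show "set us \<subseteq> gram_index r n d"
        by (auto simp: us_def gram_index_def zero_in_monoms)
      show "(fst (us ! a), fst (us ! Suc a)) \<in> star_pattern r E" if "a < Suc K" for a
        using cyc[of a] that len by (simp add: nth star_pattern_def)
      have "(vs ! Suc K, vs ! 0) \<in> E" using cyc[of "Suc K"] len by simp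
      then show "(fst (us ! 0), fst (us ! Suc K)) \<in> star_pattern r E"
        using E by (auto simp: ends star_pattern_def sparsity_pattern_def sym_def)
      show "p + p \<noteq> snd (us ! 0) + snd (us ! Suc K)" if "fst (us ! 0) = fst (us ! Suc K)" for p
        using that index_eq[of 0 "Suc K"] by (simp add: ends)
      show "a = 0 \<and> b = Suc K \<or> a = Suc K \<and> b = 0"
        if "a < K + 2" "b < K + 2" "fst (us ! a) = fst (us ! 0)" "fst (us ! b) = fst (us ! Suc K)" for a b
        using that index_eq[of a 0] index_eq[of b "Suc K"] by (simp add: nth ends)
    qed
  next
    case edge
    then obtain i j where ij: "(i, j) \<in> E" "i \<noteq> j" by (auto simp: has_edge_def)
    then have r: "i < r" "j < r" using E by (auto simp: sparsity_pattern_def)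
    show ?thesis
    \<comment> \<open>The closing pair gives the constant coefficient of the \<open>(i, j)\<close>
      entry. As \<open>i\<close> and \<open>j\<close> differ, no square is involved, and the label
      \<open>(i, x)\<close> produces only nonconstant products with \<open>(j, 0)\<close>.\<close>
    proof (rule SDSOS_on_psubset_SSOS_on_of_cycle[OF E, where K = 1 and us = "[(i, 0), (i, x), (j, 0)]"])
      have "x \<in> monoms n d" using edge by (simp add: x_def single_in_monoms)
      then show "set [(i, 0), (i, x), (j, 0)] \<subseteq> gram_index r n d"
        using r by (simp add: gram_index_def zero_in_monoms)
      show "a = 0 \<and> b = Suc 1 \<or> a = Suc 1 \<and> b = 0"
        if "a < 1 + 2" "b < 1 + 2" "fst ([(i, 0), (i, x), (j, 0)] ! b) = fst ([(i, 0), (i, x), (j, 0)] ! Suc 1)"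
          "snd ([(i, 0), (i, x), (j, 0)] ! a) + snd ([(i, 0), (i, x), (j, 0)] ! b) =
            snd ([(i, 0), (i, x), (j, 0)] ! 0) + snd ([(i, 0), (i, x), (j, 0)] ! Suc 1)"
          "fst ([(i, 0), (i, x), (j, 0)] ! a) = fst ([(i, 0), (i, x), (j, 0)] ! 0)" for a b :: nat
      proof -
        have "a = 0 \<or> a = 1 \<or> a = 2" "b = 0 \<or> b = 1 \<or> b = 2" using that by auto
        then show ?thesis using that(3-) x0 ij(2) by (elim disjE) simp_all
      qed
    qed (use ij r x0 in \<open>auto simp: star_pattern_def less_Suc_eq\<close>)
  next
    case vars
    have "Poly_Mapping.single 1 (1 :: nat) \<noteq> x"
      by (metis lookup_single_eq lookup_single_not_eq x_def zero_neq_one)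
    then show ?thesis
      using vars single_1_nonzero[of "Suc 0"]
      by (intro univariate[of "Poly_Mapping.single 1 1"] single_in_monoms) simp_all
  next
    case degree
    define y :: monom where "y = Poly_Mapping.single 0 2"
    have "mdeg y = 2" "mdeg x = 1" by (simp_all only: y_def x_def mdeg_single)
    then have "y \<noteq> 0" "y \<noteq> x" using mdeg_zero_iff[of y] by auto
    moreover have "y \<in> monoms n d"
      unfolding y_def using degree by (intro single_in_monoms) auto
    ultimately show ?thesis using degree by (intro univariate[of y]) auto
  qed
qed

section \<open>Forced zeros of positive semidefinite Gram matrices and the third inclusion\<close>

lemma psd_gram_subset:
  assumes Q: "Q \<in> carrier_mat (r * monom_count n d) (r * monom_count n d)" "psd Q"
    and S: "S \<subseteq> gram_index r n d"
  shows "0 \<le> (\<Sum>u\<in>S. \<Sum>v\<in>S. y u * y v * gram_entry n d Q u v)"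
proof -
  let ?L = "r * monom_count n d" and ?I = "gram_index r n d"
  define z where "z u = (if u \<in> S then y u else 0)" for u
  define x where "x = vec ?L (\<lambda>k. z (gram_label n d k))"
  have "0 \<le> x \<bullet> (Q *\<^sub>v x)" using Q by (simp add: psd_def x_def)
  also have "\<dots> = (\<Sum>u<?L. \<Sum>v<?L. z (gram_label n d u) * z (gram_label n d v) * Q $$ (u, v))"
    using Q(1) by (simp add: x_def scalar_prod_def lessThan_atLeast0 sum_distrib_left mult_ac)
  also have "\<dots> = (\<Sum>u\<in>?I. \<Sum>v\<in>?I. z u * z v * gram_entry n d Q u v)"
    unfolding sum_gram_index gram_entry_def by (intro sum.cong refl) (simp add: gram_label_pos)
  also have "\<dots> = (\<Sum>u\<in>S. \<Sum>v\<in>S. y u * y v * gram_entry n d Q u v)"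
  proof (rule sum.mono_neutral_cong_right[OF finite_gram_index S])
    show "\<forall>u\<in>?I - S. (\<Sum>v\<in>?I. z u * z v * gram_entry n d Q u v) = 0" by (simp add: z_def)
    show "(\<Sum>v\<in>?I. z u * z v * gram_entry n d Q u v) = (\<Sum>v\<in>S. y u * y v * gram_entry n d Q u v)"
      if "u \<in> S" for u
      by (rule sum.mono_neutral_cong_right[OF finite_gram_index S]) (auto simp: z_def that)
  qed
  finally show ?thesis .
qed

lemma psd_gram_zero_row:
  assumes Q: "Q \<in> carrier_mat (r * monom_count n d) (r * monom_count n d)" "psd Q"
    and uv: "u \<in> gram_index r n d" "v \<in> gram_index r n d" and zero: "gram_entry n d Q u u = 0"
  shows "gram_entry n d Q u v = 0"
proof (rule ccontr)
  assume nz: "gram_entry n d Q u v \<noteq> 0"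
  then have "u \<noteq> v" using zero by auto
  have sym: "gram_entry n d Q v u = gram_entry n d Q u v"
    using gram_entry_sym[OF Q(1) _ uv(2,1)] Q(2) by (simp add: psd_def)
  \<comment> \<open>Chosen so that the quadratic form, affine in \<open>t\<close> because the
    diagonal entry at \<open>u\<close> is zero, takes the value \<open>-1\<close>.\<close>
  define t where "t = - (gram_entry n d Q v v + 1) / (2 * gram_entry n d Q u v)"
  have "0 \<le> (\<Sum>a\<in>{u, v}. \<Sum>b\<in>{u, v}. (if a = u then t else 1) * (if b = u then t else 1) *
      gram_entry n d Q a b)"
    by (rule psd_gram_subset[OF Q]) (use uv in auto)
  also have "\<dots> = 2 * t * gram_entry n d Q u v + gram_entry n d Q v v"
    using \<open>u \<noteq> v\<close> zero sym by simp
  also have "\<dots> = - 1" using nz by (simp add: t_def field_simps)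
  finally show False by simp
qed

text \<open>The order compares at the first index of difference, where an exponent cannot be smaller
  than zero.\<close>

lemma monom_nonneg:
  fixes p :: monom
  shows "0 \<le> p"
proof (rule ccontr)
  assume "\<not> 0 \<le> p"
  then have "p < 0" by simp
  then show False by transfer (auto simp: less_fun_def)
qed

text \<open>The square of the largest monomial with a nonzero diagonal entry cannot be cancelled.\<close>

lemma psd_gram_constant_diagonal:
  assumes G: "gram_matrix r n d P Q" and Q: "psd Q" and j: "j < r"
    and const: "\<And>m. m \<noteq> 0 \<Longrightarrow> Poly_Mapping.lookup (P $$ (j, j)) m = 0"
    and p: "p \<in> monoms n d" "p \<noteq> 0"
  shows "gram_entry n d Q (j, p) (j, p) = 0"
proof (rule ccontr)
  assume nz: "gram_entry n d Q (j, p) (j, p) \<noteq> 0"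
  note D = gram_matrixD(1)[OF G]
  define S where "S = {q \<in> monoms n d. gram_entry n d Q (j, q) (j, q) \<noteq> 0}"
  have S: "finite S" "p \<in> S" using nz p by (auto simp: S_def finite_monoms)
  define m where "m = Max S"
  have "S \<noteq> {}" using S(2) by blast
  then have m: "m \<in> S" "p \<le> m" using S by (simp_all add: m_def)
  have mM: "m \<in> monoms n d" using m by (simp add: S_def)
  \<comment> \<open>A nonzero entry forces both diagonal entries to be nonzero, hence
    \<open>a\<close> and \<open>b\<close> are at most \<open>m\<close>. As the order is compatible
    with addition, \<open>a + b = m + m\<close> then forces equality.\<close>
  have zero: "gram_entry n d Q (j, a) (j, b) = 0"
    if ab: "a \<in> monoms n d" "b \<in> monoms n d" "a + b = m + m" "\<not> (a = m \<and> b = m)" for a b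
  proof (rule ccontr)
    assume nz: "gram_entry n d Q (j, a) (j, b) \<noteq> 0"
    have idx: "(j, a) \<in> gram_index r n d" "(j, b) \<in> gram_index r n d"
      using ab j by (simp_all add: gram_index_def)
    have "gram_entry n d Q (j, b) (j, a) = gram_entry n d Q (j, a) (j, b)"
      using gram_entry_sym[OF gram_matrixD(1,2)[OF G] idx] by simp
    then have "a \<in> S" "b \<in> S"
      using psd_gram_zero_row[OF D Q idx] psd_gram_zero_row[OF D Q idx(2,1)] nz ab
      by (auto simp: S_def)
    then have "a \<le> m" "b \<le> m" using S(1) by (simp_all add: m_def)
    then show False
      using ab(3,4) add_less_le_mono[of a m b m] add_le_less_mono[of a m b m] by fastforce
  qed
  have "m \<noteq> 0" using m(2) p(2) monom_nonneg[of p] by auto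
  then have "m + m \<noteq> 0" by (simp add: add_eq_zero_iff_monom)
  then have "0 = Poly_Mapping.lookup (P $$ (j, j)) (m + m)" by (simp add: const)
  also have "\<dots> = (\<Sum>a\<in>monoms n d. \<Sum>b\<in>monoms n d.
      if a = m then if b = m then gram_entry n d Q (j, m) (j, m) else 0 else 0)"
    unfolding gram_coeff[OF G j j] by (intro sum.cong refl) (use zero in auto)
  also have "\<dots> = (\<Sum>a\<in>monoms n d. if a = m then gram_entry n d Q (j, m) (j, m) else 0)"
    by (intro sum.cong refl) (simp add: finite_monoms mM)
  also have "\<dots> = gram_entry n d Q (j, m) (j, m)" by (simp add: finite_monoms mM)
  finally show False using m(1) by (simp add: S_def)
qed


lemma SSOS_on_psubset_SOS_on:
  assumes E: "sparsity_pattern r E" and pos: "0 < n" "0 < d" and ntrans: "\<not> trans (star_pattern r E)"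
  shows "SSOS_on r n d E \<subset> SOS_on r n d E"
proof -
  let ?I = "gram_index r n d"
  obtain i j k where path: "(i, j) \<in> star_pattern r E" "(j, k) \<in> star_pattern r E"
    and ik: "(i, k) \<notin> star_pattern r E"
    using ntrans by (auto simp: trans_def)
  have star_sym: "(b, a) \<in> star_pattern r E" if "(a, b) \<in> star_pattern r E" for a b
    using that E by (auto simp: star_pattern_def sparsity_pattern_def sym_def)
  have r: "i < r" "j < r" "k < r"
    using path E by (auto simp: star_pattern_def sparsity_pattern_def)
  have distinct: "i \<noteq> j" "j \<noteq> k" "i \<noteq> k"
    using path ik r by (auto simp: star_pattern_def)
  define x :: monom where "x = Poly_Mapping.single 0 1"
  have x: "x \<in> monoms n d" "x \<noteq> 0"
    using pos single_1_nonzero[of 0] by (simp_all add: x_def single_in_monoms)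
  have coeff_x: "Poly_Mapping.lookup (P $$ (a, b)) x =
      gram_entry n d Q (a, 0) (b, x) + gram_entry n d Q (a, x) (b, 0)"
    if "gram_matrix r n d P Q" "a < r" "b < r" for P Q a b
    unfolding x_def using gram_coeff_1[OF that, of 0] pos by simp
  \<comment> \<open>The rows of the factor: \<open>x, 1, 1\<close> for \<open>True\<close> and
    \<open>1, 0, -x\<close> for \<open>False\<close>, at the vertices \<open>i, j, k\<close>. The
    contributions \<open>x\<close> and \<open>-x\<close> to the \<open>(i, k)\<close> entry of
    \<open>P\<close> come from different Gram entries, so they cancel in \<open>P\<close> but not in
    this Gram matrix.\<close>
  define c :: "bool \<Rightarrow> nat \<times> monom \<Rightarrow> real" where
    "c l u = (if l then of_bool (u = (i, x)) + of_bool (u = (j, 0)) + of_bool (u = (k, 0))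
      else of_bool (u = (i, 0)) - of_bool (u = (k, x)))" for l u
  define A where "A u v = (\<Sum>l\<in>UNIV. c l u * c l v)" for u v
  have A: "A u v = c True u * c True v + c False u * c False v" for u v
    by (simp add: A_def UNIV_bool)
  have A_sym: "A u v = A v u" for u v by (simp add: A mult.commute)
  obtain P where G: "gram_matrix r n d P (gram_of r n d A)"
    using gram_matrix_of[of r n d A] A_sym by blast
  have entry: "gram_entry n d (gram_of r n d A) (a, p) (b, q) = A (a, p) (b, q)"
    if "a < r" "b < r" "p \<in> monoms n d" "q \<in> monoms n d" for a b p q
    using that by (intro gram_entry_of) (simp_all add: gram_index_def)
  have P_coeff: "Poly_Mapping.lookup (P $$ (a, b)) m = (\<Sum>p\<in>monoms n d. \<Sum>q\<in>monoms n d.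
      if p + q = m then A (a, p) (b, q) else 0)" if "a < r" "b < r" for a b m
    unfolding gram_coeff[OF G that] by (intro sum.cong refl) (simp add: entry that)
  have P_ik: "P $$ (i, k) = 0"
  proof (rule poly_mapping_eqI)
    fix m
    have "Poly_Mapping.lookup (P $$ (i, k)) m = (\<Sum>p\<in>monoms n d. \<Sum>q\<in>monoms n d.
        (if q = 0 then if p = x then of_bool (x = m) else 0 else 0) -
        (if q = x then if p = 0 then of_bool (x = m) else 0 else 0))"
      unfolding P_coeff[OF r(1,3)]
      by (intro sum.cong refl) (use distinct x(2) in \<open>auto simp: A c_def\<close>)
    also have "\<dots> = (\<Sum>p\<in>monoms n d. (if p = x then of_bool (x = m) else 0) -
        (if p = 0 then of_bool (x = m) else 0))"
      by (intro sum.cong refl) (use x in \<open>simp add: sum_subtractf finite_monoms zero_in_monoms\<close>)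
    also have "\<dots> = 0"
      using x by (simp add: sum_subtractf finite_monoms zero_in_monoms)
    finally show "Poly_Mapping.lookup (P $$ (i, k)) m = Poly_Mapping.lookup 0 m" by simp
  qed
  have sym_P: "P $$ (b, a) = P $$ (a, b)" if "a < r" "b < r" for a b
    using gram_matrix_sym_poly_mats[OF G] that gram_matrixD(3)[OF G]
    by (metis (mono_tags, lifting) carrier_matD index_transpose_mat(1) mem_Collect_eq sym_poly_mats_def)
  have P_zero: "P $$ (a, b) = 0" if ab: "a < r" "b < r" "(a, b) \<notin> star_pattern r E" for a b
  proof -
    have ne: "a \<noteq> b" using ab by (auto simp: star_pattern_def)
    consider "a = i" "b = k" | "a = k" "b = i" | "a \<notin> {i, j, k} \<or> b \<notin> {i, j, k}"
      using ne ab(3) path star_sym by blast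
    then show ?thesis
    proof cases
      case 1
      then show ?thesis using P_ik by simp
    next
      case 2
      then show ?thesis using P_ik sym_P[OF r(1,3)] by simp
    next
      case 3
      then have "A (a, p) (b, q) = 0" for p q by (auto simp: A c_def)
      then show ?thesis
        by (intro poly_mapping_eqI) (simp add: P_coeff[OF ab(1,2)] cong: if_cong)
    qed
  qed
  have "P \<in> SOS r n d"
    by (rule gram_factor_SOS[OF G, where K = UNIV and c = c]) (simp_all add: gram_entry_of A_def)
  moreover have "P \<in> sparse_mats r n (2 * d) E"
    using gram_matrix_sym_poly_mats[OF G] P_zero star_sym unfolding sparse_mats_def by blast
  ultimately have "P \<in> SOS_on r n d E" by (simp add: SOS_on_def)
  moreover have "P \<notin> SSOS_on r n d E"
  proof
    assume "P \<in> SSOS_on r n d E"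
    then obtain Q where Q: "gram_matrix r n d P Q" "psd Q"
      and zero: "\<And>a b. a < r \<Longrightarrow> b < r \<Longrightarrow> (a, b) \<notin> star_pattern r E \<Longrightarrow>
        block (monom_count n d) Q a b = 0\<^sub>m (monom_count n d) (monom_count n d)"
      by (auto simp: SSOS_on_def)
    let ?Q = "gram_entry n d Q"
    note D = gram_matrixD(1,2)[OF Q(1)]
    have idx: "(a, 0) \<in> ?I" "(a, x) \<in> ?I" if "a < r" for a
      using that x by (simp_all add: gram_index_def zero_in_monoms)
    have coeff0: "?Q (a, 0) (b, 0) = A (a, 0) (b, 0)" if "a < r" "b < r" for a b
      using gram_coeff_0[OF Q(1) that] gram_coeff_0[OF G that] by (simp add: entry that zero_in_monoms)
    have Q0: "?Q (j, 0) (j, 0) = 1" "?Q (k, 0) (k, 0) = 1" "?Q (k, 0) (j, 0) = 1" "?Q (j, 0) (k, 0) = 1"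
      using distinct x(2) r by (simp_all add: coeff0 A c_def)
    have Q_ik: "?Q (i, x) (k, 0) = 0" "?Q (k, 0) (i, x) = 0"
      using zero[OF r(1,3) ik] x(1) gram_entry_sym[OF D idx(2)[OF r(1)] idx(1)[OF r(3)]]
      by (simp_all add: block_zero_iff[OF D(1) r(1,3)] zero_in_monoms)
    \<comment> \<open>The entry \<open>P_jj\<close> is constant, so row \<open>(j, x)\<close> of
      \<open>Q\<close> vanishes. The coefficient \<open>1\<close> of \<open>x\<close> in
      \<open>P_ij\<close> must then sit at \<open>(i, x), (j, 0)\<close>.\<close>
    have "Poly_Mapping.lookup (P $$ (j, j)) m = 0" if "m \<noteq> 0" for m
      unfolding P_coeff[OF r(2,2)] using distinct that x(2)
      by (intro sum.neutral ballI) (auto simp: A c_def)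
    then have "?Q (j, x) (j, x) = 0"
      by (rule psd_gram_constant_diagonal[OF Q r(2) _ x])
    then have "?Q (j, x) (i, 0) = 0"
      by (rule psd_gram_zero_row[OF D(1) Q(2) idx(2)[OF r(2)] idx(1)[OF r(1)]])
    then have "?Q (i, 0) (j, x) = 0"
      using gram_entry_sym[OF D idx(1)[OF r(1)] idx(2)[OF r(2)]] by simp
    moreover have "?Q (i, 0) (j, x) + ?Q (i, x) (j, 0) = A (i, 0) (j, x) + A (i, x) (j, 0)"
      using coeff_x[OF Q(1) r(1,2)] coeff_x[OF G r(1,2)] by (simp add: entry r x zero_in_monoms)
    ultimately have Q_ij: "?Q (i, x) (j, 0) = 1" "?Q (j, 0) (i, x) = 1"
      using distinct x(2) gram_entry_sym[OF D idx(2)[OF r(1)] idx(1)[OF r(2)]]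
      by (simp_all add: A c_def)
    define s where "s = ?Q (i, x) (i, x)"
    have s: "0 \<le> s"
      using psd_gram_subset[OF D(1) Q(2), of "{(i, x)}" "\<lambda>_. 1"] idx(2)[OF r(1)]
      by (simp add: s_def)
    \<comment> \<open>Adding \<open>t\<close> times the basis vector at \<open>(i, x)\<close> to the
      isotropic vector gives the value \<open>t * (t * s - 2)\<close>. The choice of
      \<open>t\<close> keeps \<open>t * s\<close> at most \<open>1\<close>, so this is
      negative.\<close>
    define t where "t = 1 / (s + 1)"
    define y where "y u = (if u = (i, x) then t else if u = (k, 0) then 1 else -1)" for u
    have "0 \<le> (\<Sum>u\<in>{(i, x), (j, 0), (k, 0)}. \<Sum>v\<in>{(i, x), (j, 0), (k, 0)}. y u * y v * ?Q u v)"
      by (rule psd_gram_subset[OF D(1) Q(2)]) (use idx r in auto)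
    also have "\<dots> = t * (t * s - 2)"
      using distinct x(2) by (simp add: y_def Q0 Q_ik Q_ij flip: s_def) (simp add: algebra_simps)
    finally have "0 \<le> t * (t * s - 2)" .
    moreover have "0 < t" "t * s \<le> 1" using s by (simp_all add: t_def)
    ultimately show False by (simp add: zero_le_mult_iff)
  qed
  moreover have "SSOS_on r n d E \<subseteq> SOS_on r n d E" by (auto simp: SSOS_on_def)
  ultimately show ?thesis by blast
qed

text \<open>Strictness carries side conditions because cones coincide for degenerate parameters: for
  instance, all four do when \<open>r = 0\<close>, or when \<open>d = 0\<close> and there are no
  edges. For the third inclusion, failure of transitivity provides the path without closing edge,
  and \<open>n, d > 0\<close> the monomial \<open>x\<close>.\<close>

theorem proposition3:
  fixes r n d :: nat and E :: "(nat \<times> nat) set"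
  assumes "sparsity_pattern r E"
  shows "DSOS_on r n d E \<subseteq> SDSOS_on r n d E \<and>
    SDSOS_on r n d E \<subseteq> SSOS_on r n d E \<and>
    SSOS_on r n d E \<subseteq> SOS_on r n d E \<and>
    (r > 0 \<and> n > 0 \<and> d > 0 \<or> has_edge E \<longrightarrow>
      DSOS_on r n d E \<subset> SDSOS_on r n d E) \<and>
    (r > 0 \<and> n > 0 \<and> d > 0 \<and> (n > 1 \<or> d > 1 \<or> has_edge E) \<or> has_cycle E \<longrightarrow>
      SDSOS_on r n d E \<subset> SSOS_on r n d E) \<and>
    (n > 0 \<and> d > 0 \<and> \<not> trans (star_pattern r E) \<longrightarrow>
      SSOS_on r n d E \<subset> SOS_on r n d E) \<and>
    (full_pattern r E \<longrightarrow> SSOS_on r n d E = SOS_on r n d E)"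
proof (intro conjI impI)
  show "SSOS_on r n d E \<subseteq> SOS_on r n d E" by (auto simp: SSOS_on_def)
qed (simp_all add: assms DSOS_on_subset_SDSOS_on SDSOS_on_subset_SSOS_on DSOS_on_psubset_SDSOS_on
    SDSOS_on_psubset_SSOS_on SSOS_on_psubset_SOS_on SSOS_on_eq_SOS_on_full)

end
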